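(* Let $(H,u)$ be an Abelian linearly ordered unital $\ell$-group and let $M$ be a strong $(H,u)$-perfect pseudo MV-algebra. Then there is a unique (up to isomorphism) $\ell$-group $G$ such that $M\cong\Gamma(H\overrightarrow{\times}G,(u,0))$.
   Context: A pseudo MV-algebra is an algebra $(M;\oplus,{}^-,{}^\sim,0,1)$ of type $(2,1,1,0,0)$ such that, with $y\odot x:=(x^-\oplus y^-)^\sim$, for all $x,y,z\in M$: (A1) $x\oplus(y\oplus z)=(x\oplus y)\oplus z$; (A2) $x\oplus 0=0\oplus x=x$; (A3) $x\oplus 1=1\oplus x=1$; (A4) $1^\sim=0=1^-$; (A5) $(x^-\oplus y^-)^\sim=(x^\sim\oplus y^\sim)^-$; (A6) $x\oplus(x^\sim\odot y)=y\oplus(y^\sim\odot x)=(x\odot y^-)\oplus y=(y\odot x^-)\oplus x$; (A7) $x\odot(x^-\oplus y)=(x\oplus y^\sim)\odot y$; (A8) $(x^-)^\sim=x$ ($\odot$ binds stronger than $\oplus$). It is a distributive lattice, with $x\vee y$ given by (A6) and $x\wedge y$ by (A7). $\ell$-groups are lattice-ordered groups, written additively and not assumed Abelian; a unital $\ell$-group $(G,u)$ is an $\ell$-group with a strong unit $u\ge0$, i.e. $G=\bigcup_n[-nu,nu]$. $\Gamma(G,u)$ is the pseudo MV-algebra on $\{g\in G:0\le g\le u\}$ with $x\oplus y=(x+y)\wedge u$, $x^-=u-x$, $x^\sim=-x+u$, $x\odot y=(x-u+y)\vee 0$ and constants $0,u$. Every pseudo MV-algebra is isomorphic to $\Gamma(K,v)$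 for a unital $\ell$-group $(K,v)$ unique up to isomorphism. $C(K)$ is the commutative center of the group $K$. On $M$, the partial addition $x+y$ is defined iff $x\odot y=0$, and then $x+y:=x\oplus y$ (it is the group sum in $K$ when that sum lies in $[0,v]$). For a linearly ordered group $H$ and an $\ell$-group $G$, $H\overrightarrow{\times}G$ is the group $H\times G$ with the lexicographic order: $(h,g)\le(h_1,g_1)$ iff $h<h_1$, or $h=h_1$ and $g\le g_1$. Put $[0,u]_H=\{h\in H:0\le h\le u\}$. An $(H,u)$-decomposition of $M$ is a system $(M_t:t\in[0,u]_H)$ of nonempty pairwise disjoint subsets of $M$ with union $M$ such that: (a) if $s<t$, then $a\le b$ for all $a\in M_s$, $b\in M_t$; (b) $M_t^-=M_{u-t}=M_t^\sim$ for each $t$, where $M_t^-=\{x^-:x\in M_t\}$ and $M_t^\sim=\{x^\sim:x\in M_t\}$; (c) if $x\in M_v$ and $y\in M_t$, then $x\oplus y\in M_{v\oplus t}$, where $v\oplus t=\min\{v+t,u\}$. $M=\Gamma(K,w)$ is strong $(H,u)$-perfect if it has an $(H,u)$-decomposition $(M_t)$ and elements $(c_t:t\in[0,u]_H)$ of $M$ with (i) $c_t\in M_t\cap C(K)$ for each $t$; (ii) $c_v+c_t=c_{v+t}$ whenever $v+t\le u$; (iii) $c_u=1$.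
   Formalization: Uniqueness of G is claimed only among ℓ-groups for which some isomorphism M ≅ Γ(H lex G,(u,0)) maps M_0 onto the elements (0,g); the existing G has this too. Without it uniqueness fails: for H the lexicographic sum of Z over ω+1, both 0 and Z represent Γ(H,u). *)

theory Defs
  imports "HOL-Algebra.Group" "HOL-Algebra.Lattice"
begin

section \<open>Lattice-ordered groups\<close>

text \<open>
  Groups need not be commutative. They are written additively in the literature and
  multiplicatively here: \<open>x + y\<close> is \<open>x \<otimes> y\<close>, \<open>- x\<close> is \<open>inv x\<close>, \<open>0\<close> is \<open>\<one>\<close>, and
  \<open>n x\<close> is \<open>x [^] n\<close>.
\<close>

record 'a po_group = "'a monoid" +
  gle :: "'a \<Rightarrow> 'a \<Rightarrow> bool" (infixl "\<preceq>\<index>" 50)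

definition order_of :: "('a, 'b) po_group_scheme \<Rightarrow> 'a gorder" where
  "order_of G = \<lparr>carrier = carrier G, eq = (=), le = gle G\<rparr>"

locale l_group = group G for G (structure) +
  assumes lattice_order: "lattice (order_of G)"
    and translation: "\<lbrakk>x \<in> carrier G; y \<in> carrier G; a \<in> carrier G; b \<in> carrier G; x \<preceq> y\<rbrakk>
      \<Longrightarrow> a \<otimes> x \<otimes> b \<preceq> a \<otimes> y \<otimes> b"

locale unital_l_group = l_group G for G (structure) and u +
  assumes unit_closed: "u \<in> carrier G"
    and unit_nonneg: "\<one> \<preceq> u"
    and strong_unit: "g \<in> carrier G \<Longrightarrow> \<exists>n::nat. inv (u [^] n) \<preceq> g \<and> g \<preceq> u [^] n"

definition interval :: "('a, 'b) po_group_scheme \<Rightarrow> 'a \<Rightarrow> 'a set" where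
  "interval G u = {g \<in> carrier G. \<one>\<^bsub>G\<^esub> \<preceq>\<^bsub>G\<^esub> g \<and> g \<preceq>\<^bsub>G\<^esub> u}"

definition commutative_center :: "('a, 'b) monoid_scheme \<Rightarrow> 'a set" where
  "commutative_center G = {z \<in> carrier G. \<forall>g\<in>carrier G. z \<otimes>\<^bsub>G\<^esub> g = g \<otimes>\<^bsub>G\<^esub> z}"

definition lex_prod :: "('h, 'b) po_group_scheme \<Rightarrow> ('g, 'c) po_group_scheme \<Rightarrow> ('h \<times> 'g) po_group"
    (infixr "\<times>\<^sub>l\<^sub>e\<^sub>x" 80) where
  "H \<times>\<^sub>l\<^sub>e\<^sub>x G =
    \<lparr>carrier = carrier (H \<times>\<times> G), mult = mult (H \<times>\<times> G), one = one (H \<times>\<times> G),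
     gle = (\<lambda>(h, g) (h', g'). (h \<preceq>\<^bsub>H\<^esub> h' \<and> h \<noteq> h') \<or> (h = h' \<and> g \<preceq>\<^bsub>G\<^esub> g'))\<rparr>"

definition l_group_isomorphic ::
    "('a, 'c) po_group_scheme \<Rightarrow> ('b, 'd) po_group_scheme \<Rightarrow> bool" where
  "l_group_isomorphic G G' \<longleftrightarrow>
    (\<exists>f \<in> iso G G'. \<forall>x\<in>carrier G. \<forall>y\<in>carrier G. x \<preceq>\<^bsub>G\<^esub> y \<longleftrightarrow> f x \<preceq>\<^bsub>G'\<^esub> f y)"


section \<open>Pseudo MV-algebras\<close>

text \<open>\<open>lneg M x\<close> is \<open>x\<close> with exponent minus and \<open>rneg M x\<close> is \<open>x\<close> with exponent tilde.\<close>

record 'a pseudo_mv = "'a partial_object" +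
  mplus :: "'a \<Rightarrow> 'a \<Rightarrow> 'a" (infixl "\<boxplus>\<index>" 65)
  lneg :: "'a \<Rightarrow> 'a"
  rneg :: "'a \<Rightarrow> 'a"
  mzero :: 'a
  mone :: 'a

definition mtimes :: "('a, 'b) pseudo_mv_scheme \<Rightarrow> 'a \<Rightarrow> 'a \<Rightarrow> 'a" (infixl "\<boxdot>\<index>" 70) where
  "y \<boxdot>\<^bsub>M\<^esub> x = rneg M (lneg M x \<boxplus>\<^bsub>M\<^esub> lneg M y)"

locale pseudo_mv_algebra =
  fixes M (structure)
  assumes mplus_closed: "\<lbrakk>x \<in> carrier M; y \<in> carrier M\<rbrakk> \<Longrightarrow> x \<boxplus> y \<in> carrier M"
    and lneg_closed: "x \<in> carrier M \<Longrightarrow> lneg M x \<in> carrier M"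
    and rneg_closed: "x \<in> carrier M \<Longrightarrow> rneg M x \<in> carrier M"
    and mzero_closed: "mzero M \<in> carrier M"
    and mone_closed: "mone M \<in> carrier M"
    and A1: "\<lbrakk>x \<in> carrier M; y \<in> carrier M; z \<in> carrier M\<rbrakk>
      \<Longrightarrow> x \<boxplus> (y \<boxplus> z) = (x \<boxplus> y) \<boxplus> z"
    and A2: "x \<in> carrier M \<Longrightarrow> x \<boxplus> mzero M = x"
      "x \<in> carrier M \<Longrightarrow> mzero M \<boxplus> x = x"
    and A3: "x \<in> carrier M \<Longrightarrow> x \<boxplus> mone M = mone M"
      "x \<in> carrier M \<Longrightarrow> mone M \<boxplus> x = mone M"
    and A4: "rneg M (mone M) = mzero M" "lneg M (mone M) = mzero M"
    and A5: "\<lbrakk>x \<in> carrier M; y \<in> carrier M\<rbrakk>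
      \<Longrightarrow> rneg M (lneg M x \<boxplus> lneg M y) = lneg M (rneg M x \<boxplus> rneg M y)"
    and A6: "\<lbrakk>x \<in> carrier M; y \<in> carrier M\<rbrakk>
      \<Longrightarrow> x \<boxplus> (rneg M x \<boxdot> y) = y \<boxplus> (rneg M y \<boxdot> x)"
      "\<lbrakk>x \<in> carrier M; y \<in> carrier M\<rbrakk>
      \<Longrightarrow> y \<boxplus> (rneg M y \<boxdot> x) = (x \<boxdot> lneg M y) \<boxplus> y"
      "\<lbrakk>x \<in> carrier M; y \<in> carrier M\<rbrakk>
      \<Longrightarrow> (x \<boxdot> lneg M y) \<boxplus> y = (y \<boxdot> lneg M x) \<boxplus> x"
    and A7: "\<lbrakk>x \<in> carrier M; y \<in> carrier M\<rbrakk>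
      \<Longrightarrow> x \<boxdot> (lneg M x \<boxplus> y) = (x \<boxplus> rneg M y) \<boxdot> y"
    and A8: "x \<in> carrier M \<Longrightarrow> rneg M (lneg M x) = x"

text \<open>The join of \<open>x\<close> and \<open>y\<close> is the common value in A6, so \<open>x\<close> is below \<open>y\<close> iff it equals \<open>y\<close>.\<close>

definition mle :: "('a, 'b) pseudo_mv_scheme \<Rightarrow> 'a \<Rightarrow> 'a \<Rightarrow> bool" where
  "mle M x y \<longleftrightarrow> x \<boxplus>\<^bsub>M\<^esub> (rneg M x \<boxdot>\<^bsub>M\<^esub> y) = y"

text \<open>The partial sum of \<open>x\<close> and \<open>y\<close> is defined and equals \<open>z\<close>.\<close>

definition is_partial_sum :: "('a, 'b) pseudo_mv_scheme \<Rightarrow> 'a \<Rightarrow> 'a \<Rightarrow> 'a \<Rightarrow> bool" where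
  "is_partial_sum M x y z \<longleftrightarrow> x \<boxdot>\<^bsub>M\<^esub> y = mzero M \<and> x \<boxplus>\<^bsub>M\<^esub> y = z"

definition pseudo_mv_iso ::
    "('a, 'c) pseudo_mv_scheme \<Rightarrow> ('b, 'd) pseudo_mv_scheme \<Rightarrow> ('a \<Rightarrow> 'b) set" where
  "pseudo_mv_iso M N = {f. bij_betw f (carrier M) (carrier N) \<and>
    (\<forall>x\<in>carrier M. \<forall>y\<in>carrier M. f (x \<boxplus>\<^bsub>M\<^esub> y) = f x \<boxplus>\<^bsub>N\<^esub> f y) \<and>
    (\<forall>x\<in>carrier M. f (lneg M x) = lneg N (f x) \<and> f (rneg M x) = rneg N (f x)) \<and>
    f (mzero M) = mzero N \<and> f (mone M) = mone N}"

text \<open>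
  The product \<open>x - u + y\<close> joined with \<open>0\<close> is not a field of the record: it is what
  \<^const>\<open>mtimes\<close> evaluates to in this algebra.
\<close>

definition Gamma :: "('a, 'b) po_group_scheme \<Rightarrow> 'a \<Rightarrow> 'a pseudo_mv" where
  "Gamma G u =
    \<lparr>carrier = interval G u,
     mplus = (\<lambda>x y. (x \<otimes>\<^bsub>G\<^esub> y) \<sqinter>\<^bsub>order_of G\<^esub> u),
     lneg = (\<lambda>x. u \<otimes>\<^bsub>G\<^esub> inv\<^bsub>G\<^esub> x),
     rneg = (\<lambda>x. inv\<^bsub>G\<^esub> x \<otimes>\<^bsub>G\<^esub> u),
     mzero = \<one>\<^bsub>G\<^esub>,
     mone = u\<rparr>"


section \<open>Decompositions\<close>

locale hu_decomposition =
  fixes H :: "('h, 'b) po_group_scheme" (structure) and u :: 'h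
    and M :: "('m, 'c) pseudo_mv_scheme" and D :: "'h \<Rightarrow> 'm set"
  assumes part_nonempty: "t \<in> interval H u \<Longrightarrow> D t \<noteq> {}"
    and parts_disjoint: "\<lbrakk>s \<in> interval H u; t \<in> interval H u; s \<noteq> t\<rbrakk> \<Longrightarrow> D s \<inter> D t = {}"
    and parts_union: "(\<Union>t\<in>interval H u. D t) = carrier M"
    and parts_ordered: "\<lbrakk>s \<in> interval H u; t \<in> interval H u; s \<preceq> t; s \<noteq> t; a \<in> D s; b \<in> D t\<rbrakk>
      \<Longrightarrow> mle M a b"
    and parts_lneg: "t \<in> interval H u \<Longrightarrow> lneg M ` D t = D (u \<otimes> inv t)"
    and parts_rneg: "t \<in> interval H u \<Longrightarrow> rneg M ` D t = D (u \<otimes> inv t)"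
    and parts_mplus: "\<lbrakk>v \<in> interval H u; t \<in> interval H u; x \<in> D v; y \<in> D t\<rbrakk>
      \<Longrightarrow> x \<boxplus>\<^bsub>M\<^esub> y \<in> D (if v \<otimes> t \<preceq> u then v \<otimes> t else u)"

text \<open>
  The isomorphism \<open>\<phi>\<close> realizes the identification of \<open>M\<close> with the algebra \<^term>\<open>Gamma K w\<close>
  that gives a meaning to the condition that \<open>c t\<close> lies in the commutative center of \<open>K\<close>.
\<close>

locale strong_hu_perfect = hu_decomposition H u M D + pseudo_mv_algebra M
  for H :: "('h, 'b) po_group_scheme" (structure) and u :: 'h
    and M :: "('m, 'c) pseudo_mv_scheme" and D :: "'h \<Rightarrow> 'm set" +
  fixes K :: "('k, 'd) po_group_scheme" and w :: 'k and \<phi> :: "'m \<Rightarrow> 'k" and c :: "'h \<Rightarrow> 'm"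
  assumes unital_K: "unital_l_group K w"
    and \<phi>_iso: "\<phi> \<in> pseudo_mv_iso M (Gamma K w)"
    and c_in_part: "t \<in> interval H u \<Longrightarrow> c t \<in> D t"
    and c_central: "t \<in> interval H u \<Longrightarrow> \<phi> (c t) \<in> commutative_center K"
    and c_sum: "\<lbrakk>v \<in> interval H u; t \<in> interval H u; v \<otimes> t \<preceq> u\<rbrakk>
      \<Longrightarrow> is_partial_sum M (c v) (c t) (c (v \<otimes> t))"
    and c_unit: "c u = mone M"

text \<open>
  The bottom component of the algebra obtained from the lexicographic product by the
  first coordinate. An isomorphism from \<open>M\<close> need not map \<open>D\<close> at \<open>0\<close> onto it, and without that
  condition \<open>G\<close> is not determined up to isomorphism. Let \<open>H\<close> be the lexicographic direct sum of
  copies of the integers over the index chain \<open>\<omega> + 1\<close>, larger indices dominating, and let \<open>u\<close>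
  be the generator at the top index. Since \<open>1 + \<omega> + 1 = \<omega> + 1\<close>, the lexicographic products of
  \<open>H\<close> with the integers and of \<open>H\<close> with the trivial group are isomorphic, unit to unit.
\<close>

definition bottom_component ::
    "('h, 'b) po_group_scheme \<Rightarrow> 'h \<Rightarrow> ('g, 'c) po_group_scheme \<Rightarrow> ('h \<times> 'g) set" where
  "bottom_component H u G =
    {x \<in> carrier (Gamma (H \<times>\<^sub>l\<^sub>e\<^sub>x G) (u, \<one>\<^bsub>G\<^esub>)). fst x = \<one>\<^bsub>H\<^esub>}"

end

theory Submission
  imports Defs
begin

text \<open>
  Identify \<open>M\<close> with the interval \<open>[0, w]\<close> of \<open>K\<close>. The bottom part \<open>M\<^sub>0\<close> is a downward closed
  submonoid of the positive cone, hence the positive cone of the convex \<open>\<ell>\<close>-subgroup \<open>G\<close> of all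
  elements of \<open>K\<close> lying between \<open>-b\<close> and \<open>a\<close> for some \<open>a\<close>, \<open>b\<close> in \<open>M\<^sub>0\<close>. Each \<open>x\<close> in \<open>M\<^sub>t\<close>
  differs from the central element \<open>c\<^sub>t\<close> by an element of \<open>G\<close>, and \<open>x \<mapsto> (t, x - c\<^sub>t)\<close> is the
  isomorphism. The sums of elements of \<open>M\<^sub>0\<close> do not exceed \<open>1\<close>, so \<open>M\<^sub>0\<close> determines the positive
  cone of \<open>G\<close> as a monoid, and an \<open>\<ell>\<close>-group is determined by the monoid of its positive elements.
\<close>

section \<open>Lattice-ordered groups\<close>

text \<open>The axioms speak only of elements between 0 and \<open>w\<close> and of sums truncated
  at \<open>w\<close>, whereas the difference of \<open>x\<close> and \<open>c t\<close> has no
  sign. Two devices make indices computable all the same. Truncation is inactive once s + t < u: for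
  x of index s and y of index t, the element w - y has index u - t > s and so lies above x. At the
  index u itself an overflow cannot be told from an exact sum, so elements there are reached through
  their complements, which have index 0. Further, subtracting the meet of \<open>x\<close> and
  \<open>c t\<close> from both leaves two orthogonal positive elements of the interval, which do
  have indices.

  Centrality turns the coordinates into a homomorphism, since \<open>c s\<close> has to move past y
  in (x - c s) + (y - c t). As \<open>w\<close> is the image of \<open>c u\<close>, it is central
  too, and both negations agree. The case u = 0 stands apart: the strict separation of index 0 from
  index u disappears, and all groups involved are trivial.\<close>

lemma order_of_simps [simp]:
  "carrier (order_of G) = carrier G"
  "eq (order_of G) = (=)"
  "le (order_of G) = gle G"
  by (simp_all add: order_of_def)

lemma (in l_group) po_refl: "x \<in> carrier G \<Longrightarrow> x \<preceq> x"
proof -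
  interpret L: lattice "order_of G" by (rule lattice_order)
  show "x \<in> carrier G \<Longrightarrow> x \<preceq> x" using L.le_refl by simp
qed

lemma (in l_group) po_antisym:
  "\<lbrakk>x \<preceq> y; y \<preceq> x; x \<in> carrier G; y \<in> carrier G\<rbrakk> \<Longrightarrow> x = y"
proof -
  interpret L: lattice "order_of G" by (rule lattice_order)
  show "\<lbrakk>x \<preceq> y; y \<preceq> x; x \<in> carrier G; y \<in> carrier G\<rbrakk> \<Longrightarrow> x = y"
    using L.le_antisym by simp
qed

lemma (in l_group) po_trans:
  "\<lbrakk>x \<preceq> y; y \<preceq> z; x \<in> carrier G; y \<in> carrier G; z \<in> carrier G\<rbrakk> \<Longrightarrow> x \<preceq> z"
proof -
  interpret L: lattice "order_of G" by (rule lattice_order)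
  show "\<lbrakk>x \<preceq> y; y \<preceq> z; x \<in> carrier G; y \<in> carrier G; z \<in> carrier G\<rbrakk> \<Longrightarrow> x \<preceq> z"
    using L.le_trans by simp
qed

lemma (in l_group)
  assumes "x \<in> carrier G" "y \<in> carrier G"
  shows inf_closed [simp]: "x \<sqinter>\<^bsub>order_of G\<^esub> y \<in> carrier G"
    and inf_left: "x \<sqinter>\<^bsub>order_of G\<^esub> y \<preceq> x"
    and inf_right: "x \<sqinter>\<^bsub>order_of G\<^esub> y \<preceq> y"
    and inf_greatest: "\<lbrakk>z \<in> carrier G; z \<preceq> x; z \<preceq> y\<rbrakk> \<Longrightarrow> z \<preceq> x \<sqinter>\<^bsub>order_of G\<^esub> y"
proof -
  interpret L: lattice "order_of G" by (rule lattice_order)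
  show "x \<sqinter>\<^bsub>order_of G\<^esub> y \<in> carrier G" "x \<sqinter>\<^bsub>order_of G\<^esub> y \<preceq> x" "x \<sqinter>\<^bsub>order_of G\<^esub> y \<preceq> y"
    using L.meet_closed L.meet_left L.meet_right assms by simp_all
  show "\<lbrakk>z \<in> carrier G; z \<preceq> x; z \<preceq> y\<rbrakk> \<Longrightarrow> z \<preceq> x \<sqinter>\<^bsub>order_of G\<^esub> y"
    using L.meet_le[of z x y] assms by simp
qed

lemma (in l_group) inf_eqI:
  assumes "x \<in> carrier G" "y \<in> carrier G" "m \<in> carrier G" "m \<preceq> x" "m \<preceq> y"
    and "\<And>z. \<lbrakk>z \<in> carrier G; z \<preceq> x; z \<preceq> y\<rbrakk> \<Longrightarrow> z \<preceq> m"
  shows "x \<sqinter>\<^bsub>order_of G\<^esub> y = m"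
  using assms(1-5) assms(6)[OF _ inf_left inf_right] inf_greatest
  by (intro po_antisym) auto

lemma (in l_group) inf_absorb1:
  "\<lbrakk>x \<in> carrier G; y \<in> carrier G; x \<preceq> y\<rbrakk> \<Longrightarrow> x \<sqinter>\<^bsub>order_of G\<^esub> y = x"
  by (intro inf_eqI) (auto intro: po_refl)

lemma (in l_group) inf_absorb2:
  "\<lbrakk>x \<in> carrier G; y \<in> carrier G; y \<preceq> x\<rbrakk> \<Longrightarrow> x \<sqinter>\<^bsub>order_of G\<^esub> y = y"
  by (intro inf_eqI) (auto intro: po_refl)

lemma (in l_group) mult_right_mono:
  assumes "x \<in> carrier G" "y \<in> carrier G" "a \<in> carrier G" "x \<preceq> y"
  shows "x \<otimes> a \<preceq> y \<otimes> a"
  using translation[of x y \<one> a] assms by simp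

lemma (in l_group) mult_left_mono:
  assumes "x \<in> carrier G" "y \<in> carrier G" "a \<in> carrier G" "x \<preceq> y"
  shows "a \<otimes> x \<preceq> a \<otimes> y"
  using translation[of x y a \<one>] assms by simp

lemma (in l_group) mult_mono:
  assumes "x \<in> carrier G" "y \<in> carrier G" "a \<in> carrier G" "b \<in> carrier G" "x \<preceq> y" "a \<preceq> b"
  shows "x \<otimes> a \<preceq> y \<otimes> b"
  using assms po_trans[OF mult_right_mono[of x y a] mult_left_mono[of a b y]] by simp

lemma (in l_group) le_divide_iff:
  assumes "x \<in> carrier G" "y \<in> carrier G" "z \<in> carrier G"
  shows "x \<preceq> y \<otimes> inv z \<longleftrightarrow> x \<otimes> z \<preceq> y"
  using mult_right_mono[of x "y \<otimes> inv z" z] mult_right_mono[of "x \<otimes> z" y "inv z"] assms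
  by (auto simp: m_assoc)

lemma (in l_group) divide_le_iff:
  assumes "x \<in> carrier G" "y \<in> carrier G" "z \<in> carrier G"
  shows "x \<otimes> inv z \<preceq> y \<longleftrightarrow> x \<preceq> y \<otimes> z"
  using mult_right_mono[of "x \<otimes> inv z" y z] mult_right_mono[of x "y \<otimes> z" "inv z"] assms
  by (auto simp: m_assoc)

lemma (in l_group) le_ldivide_iff:
  assumes "x \<in> carrier G" "y \<in> carrier G" "z \<in> carrier G"
  shows "x \<preceq> inv z \<otimes> y \<longleftrightarrow> z \<otimes> x \<preceq> y"
  using mult_left_mono[of x "inv z \<otimes> y" z] mult_left_mono[of "z \<otimes> x" y "inv z"] assms
  by (auto simp: m_assoc[symmetric])

lemma (in l_group) ldivide_le_iff:
  assumes "x \<in> carrier G" "y \<in> carrier G" "z \<in> carrier G"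
  shows "inv z \<otimes> x \<preceq> y \<longleftrightarrow> x \<preceq> z \<otimes> y"
  using mult_left_mono[of "inv z \<otimes> x" y z] mult_left_mono[of x "z \<otimes> y" "inv z"] assms
  by (auto simp: m_assoc[symmetric])

lemma (in l_group) inv_antimono_iff:
  assumes "x \<in> carrier G" "y \<in> carrier G"
  shows "inv x \<preceq> inv y \<longleftrightarrow> y \<preceq> x"
  using le_divide_iff[of "inv x" \<one> y] ldivide_le_iff[of y \<one> x] assms by simp

lemma (in l_group) one_le_inv_iff: "x \<in> carrier G \<Longrightarrow> \<one> \<preceq> inv x \<longleftrightarrow> x \<preceq> \<one>"
  using inv_antimono_iff[of \<one> x] by simp

lemma (in l_group) one_le_mult:
  "\<lbrakk>x \<in> carrier G; y \<in> carrier G; \<one> \<preceq> x; \<one> \<preceq> y\<rbrakk> \<Longrightarrow> \<one> \<preceq> x \<otimes> y"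
  using mult_mono[of \<one> x \<one> y] by simp

lemma (in l_group) le_mult_right: "\<lbrakk>x \<in> carrier G; a \<in> carrier G; \<one> \<preceq> a\<rbrakk> \<Longrightarrow> x \<preceq> x \<otimes> a"
  using mult_left_mono[of \<one> a x] by simp

lemma (in l_group) le_mult_left: "\<lbrakk>x \<in> carrier G; a \<in> carrier G; \<one> \<preceq> a\<rbrakk> \<Longrightarrow> x \<preceq> a \<otimes> x"
  using mult_right_mono[of \<one> a x] by simp

lemma (in l_group) inf_mult_right:
  assumes "x \<in> carrier G" "y \<in> carrier G" "a \<in> carrier G"
  shows "(x \<otimes> a) \<sqinter>\<^bsub>order_of G\<^esub> (y \<otimes> a) = (x \<sqinter>\<^bsub>order_of G\<^esub> y) \<otimes> a"
proof (rule inf_eqI)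
  fix z assume "z \<in> carrier G" "z \<preceq> x \<otimes> a" "z \<preceq> y \<otimes> a"
  then have "z \<otimes> inv a \<preceq> x \<sqinter>\<^bsub>order_of G\<^esub> y"
    using assms by (intro inf_greatest) (simp_all add: divide_le_iff)
  then show "z \<preceq> (x \<sqinter>\<^bsub>order_of G\<^esub> y) \<otimes> a"
    using assms \<open>z \<in> carrier G\<close> by (simp add: divide_le_iff)
qed (use assms in \<open>auto intro: mult_right_mono inf_left inf_right\<close>)

text \<open>The element -a + b lies below b because a is positive, and below a because b is at most
  2a. Hence it lies below their meet 0, so b is below a and coincides with the meet.\<close>

lemma (in l_group) orthogonal_dominated:
  assumes "a \<in> carrier G" "b \<in> carrier G" "\<one> \<preceq> a" "a \<sqinter>\<^bsub>order_of G\<^esub> b = \<one>" "b \<preceq> a \<otimes> a"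
  shows "b \<preceq> \<one>"
proof -
  have "inv a \<otimes> b \<preceq> b" "inv a \<otimes> b \<preceq> a"
    using assms le_mult_left[of b a] by (simp_all add: ldivide_le_iff)
  then have "inv a \<otimes> b \<preceq> \<one>"
    using inf_greatest[of a b "inv a \<otimes> b"] assms by simp
  then have "b \<preceq> a" using assms by (simp add: ldivide_le_iff)
  then show ?thesis using inf_greatest[of a b b] assms po_refl by simp
qed

lemma l_groupI:
  fixes G (structure)
  assumes "group G"
    and refl: "\<And>x. x \<in> carrier G \<Longrightarrow> x \<preceq> x"
    and antisym: "\<And>x y. \<lbrakk>x \<preceq> y; y \<preceq> x; x \<in> carrier G; y \<in> carrier G\<rbrakk> \<Longrightarrow> x = y"
    and trans: "\<And>x y z. \<lbrakk>x \<preceq> y; y \<preceq> z; x \<in> carrier G; y \<in> carrier G; z \<in> carrier G\<rbrakk> \<Longrightarrow> x \<preceq> z"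
    and translation: "\<And>x y a b. \<lbrakk>x \<in> carrier G; y \<in> carrier G; a \<in> carrier G; b \<in> carrier G; x \<preceq> y\<rbrakk>
      \<Longrightarrow> a \<otimes> x \<otimes> b \<preceq> a \<otimes> y \<otimes> b"
    and glb: "\<And>x y. \<lbrakk>x \<in> carrier G; y \<in> carrier G\<rbrakk>
      \<Longrightarrow> \<exists>m\<in>carrier G. m \<preceq> x \<and> m \<preceq> y \<and> (\<forall>z\<in>carrier G. z \<preceq> x \<longrightarrow> z \<preceq> y \<longrightarrow> z \<preceq> m)"
  shows "l_group G"
proof -
  interpret group G by fact
  have inv_anti: "inv y \<preceq> inv x" if "x \<in> carrier G" "y \<in> carrier G" "x \<preceq> y" for x y
    using translation[of x y "inv y" "inv x"] that by (simp add: m_assoc)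
  show ?thesis
  proof (intro l_group.intro l_group_axioms.intro)
    show "lattice (order_of G)"
    proof (unfold_locales)
      fix x y assume xy: "x \<in> carrier (order_of G)" "y \<in> carrier (order_of G)"
      then obtain m where "m \<in> carrier G" "m \<preceq> x" "m \<preceq> y"
        "\<forall>z\<in>carrier G. z \<preceq> x \<longrightarrow> z \<preceq> y \<longrightarrow> z \<preceq> m"
        using glb[of x y] by auto
      then show "\<exists>s. greatest (order_of G) s (Lower (order_of G) {x, y})"
        using xy by (intro exI[of _ m]) (auto simp: greatest_def Lower_def)
      text \<open>Inversion reverses the order, so the join is the inverse of the meet of the inverses.\<close>
      obtain j where j: "j \<in> carrier G" "j \<preceq> inv x" "j \<preceq> inv y"
        "\<forall>z\<in>carrier G. z \<preceq> inv x \<longrightarrow> z \<preceq> inv y \<longrightarrow> z \<preceq> j"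
        using glb[of "inv x" "inv y"] xy by auto
      have "x \<preceq> inv j" "y \<preceq> inv j"
        using inv_anti[of j "inv x"] inv_anti[of j "inv y"] j xy by auto
      moreover have "inv j \<preceq> z" if "z \<in> carrier G" "x \<preceq> z" "y \<preceq> z" for z
        using inv_anti[of x z] inv_anti[of y z] inv_anti[of "inv z" j] j xy that by auto
      ultimately show "\<exists>s. least (order_of G) s (Upper (order_of G) {x, y})"
        using xy j by (intro exI[of _ "inv j"]) (auto simp: least_def Upper_def)
    qed (auto intro: refl antisym trans)
  qed (use translation in \<open>auto intro: \<open>group G\<close>\<close>)
qed

section \<open>Extending isomorphisms of positive cones\<close>

definition positive_cone :: "('a, 'b) po_group_scheme \<Rightarrow> 'a set" where
  "positive_cone G = {g \<in> carrier G. \<one>\<^bsub>G\<^esub> \<preceq>\<^bsub>G\<^esub> g}"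

lemma l_group_isomorphic_sym:
  assumes "l_group G" "l_group_isomorphic G G'"
  shows "l_group_isomorphic G' G"
proof -
  interpret l_group G by fact
  obtain f where f: "f \<in> iso G G'"
    and le: "\<forall>x\<in>carrier G. \<forall>y\<in>carrier G. x \<preceq>\<^bsub>G\<^esub> y \<longleftrightarrow> f x \<preceq>\<^bsub>G'\<^esub> f y"
    using assms(2) by (auto simp: l_group_isomorphic_def)
  have img: "f ` carrier G = carrier G'"
    using f by (simp add: iso_def bij_betw_def)
  have "x \<preceq>\<^bsub>G'\<^esub> y \<longleftrightarrow> inv_into (carrier G) f x \<preceq>\<^bsub>G\<^esub> inv_into (carrier G) f y"
    if "x \<in> carrier G'" "y \<in> carrier G'" for x y
    using le that img by (metis f_inv_into_f inv_into_into)
  then show ?thesis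
    using iso_set_sym[OF f] by (auto simp: l_group_isomorphic_def)
qed

text \<open>Supplies common denominators: x = (x + n) - n and y = (y + n) - n with positive terms.
  The negative of the meet of x, y and 0 serves as n.\<close>

lemma (in l_group) ex_common_bound:
  assumes "x \<in> carrier G" "y \<in> carrier G"
  shows "\<exists>n\<in>positive_cone G. \<one> \<preceq> x \<otimes> n \<and> \<one> \<preceq> y \<otimes> n"
proof -
  define m where "m = (x \<sqinter>\<^bsub>order_of G\<^esub> y) \<sqinter>\<^bsub>order_of G\<^esub> \<one>"
  have m: "m \<in> carrier G" "m \<preceq> \<one>" using assms by (auto simp: m_def inf_right)
  have "m \<preceq> x \<sqinter>\<^bsub>order_of G\<^esub> y" using assms by (simp add: m_def inf_left)
  then have "m \<preceq> x" "m \<preceq> y"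
    using assms m(1) by (blast intro: po_trans inf_left inf_right inf_closed)+
  then show ?thesis
    using assms m by (intro bexI[of _ "inv m"]) (auto simp: le_divide_iff positive_cone_def one_le_inv_iff)
qed

text \<open>The extension sends \<open>x\<close> to \<open>p (x + n) - p n\<close> for any positive \<open>n\<close> with \<open>x + n\<close> positive.\<close>

lemma positive_cone_iso_extends:
  assumes "l_group G" "l_group G'"
    and bij: "bij_betw p (positive_cone G) (positive_cone G')"
    and hom: "\<And>x y. \<lbrakk>x \<in> positive_cone G; y \<in> positive_cone G\<rbrakk>
      \<Longrightarrow> p (x \<otimes>\<^bsub>G\<^esub> y) = p x \<otimes>\<^bsub>G'\<^esub> p y"
  shows "l_group_isomorphic G G'"
proof -
  interpret G: l_group G by fact
  interpret G': l_group G' by fact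
  let ?P = "positive_cone G" and ?P' = "positive_cone G'"
  have P: "x \<in> carrier G" "\<one>\<^bsub>G\<^esub> \<preceq>\<^bsub>G\<^esub> x" if "x \<in> ?P" for x using that by (auto simp: positive_cone_def)
  have P': "x \<in> carrier G'" "\<one>\<^bsub>G'\<^esub> \<preceq>\<^bsub>G'\<^esub> x" if "x \<in> ?P'" for x
    using that by (auto simp: positive_cone_def)
  have p: "p x \<in> ?P'" if "x \<in> ?P" for x using bij that by (auto simp: bij_betw_def)
  note pc = P'(1)[OF p]
  have one: "\<one>\<^bsub>G\<^esub> \<in> ?P" by (simp add: positive_cone_def G.po_refl)
  have p_one: "p \<one>\<^bsub>G\<^esub> = \<one>\<^bsub>G'\<^esub>"
    using hom[OF one one] pc[OF one] by simp
  define F where "F x = (let n = SOME n. n \<in> ?P \<and> x \<otimes>\<^bsub>G\<^esub> n \<in> ?P in p (x \<otimes>\<^bsub>G\<^esub> n) \<otimes>\<^bsub>G'\<^esub> inv\<^bsub>G'\<^esub> p n)" for x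
  \<comment> \<open>Enlarging the denominator on the right is harmless, as p m cancels against its
    inverse in the middle of the product.\<close>
  have shift: "p (x \<otimes>\<^bsub>G\<^esub> n) \<otimes>\<^bsub>G'\<^esub> inv\<^bsub>G'\<^esub> p n = p (x \<otimes>\<^bsub>G\<^esub> n \<otimes>\<^bsub>G\<^esub> m) \<otimes>\<^bsub>G'\<^esub> inv\<^bsub>G'\<^esub> p (n \<otimes>\<^bsub>G\<^esub> m)"
    if "x \<in> carrier G" "n \<in> ?P" "x \<otimes>\<^bsub>G\<^esub> n \<in> ?P" "m \<in> ?P" for x n m
    using that pc[OF that(2)] pc[OF that(3)] pc[OF that(4)] P(1)
    by (simp add: hom G'.inv_mult_group G'.m_assoc G'.inv_solve_left') (simp add: G'.m_assoc[symmetric])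
  have indep: "p (x \<otimes>\<^bsub>G\<^esub> n) \<otimes>\<^bsub>G'\<^esub> inv\<^bsub>G'\<^esub> p n = p (x \<otimes>\<^bsub>G\<^esub> n') \<otimes>\<^bsub>G'\<^esub> inv\<^bsub>G'\<^esub> p n'"
    if x: "x \<in> carrier G" and n: "n \<in> ?P" "x \<otimes>\<^bsub>G\<^esub> n \<in> ?P" and n': "n' \<in> ?P" "x \<otimes>\<^bsub>G\<^esub> n' \<in> ?P" for x n n'
  proof -
    \<comment> \<open>Without commutativity n + n' and n' + n may differ, so shifting each
      denominator by the other need not produce a common one. Instead j is taken above both, and -n
      + j and -n' + j are positive shifts leading to j.\<close>
    obtain j where j: "j \<in> ?P" "\<one>\<^bsub>G\<^esub> \<preceq>\<^bsub>G\<^esub> inv\<^bsub>G\<^esub> n \<otimes>\<^bsub>G\<^esub> j" "\<one>\<^bsub>G\<^esub> \<preceq>\<^bsub>G\<^esub> inv\<^bsub>G\<^esub> n' \<otimes>\<^bsub>G\<^esub> j"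
      using G.ex_common_bound[of "inv\<^bsub>G\<^esub> n" "inv\<^bsub>G\<^esub> n'"] P n n' by auto
    let ?m = "inv\<^bsub>G\<^esub> n \<otimes>\<^bsub>G\<^esub> j" and ?m' = "inv\<^bsub>G\<^esub> n' \<otimes>\<^bsub>G\<^esub> j"
    note c = P(1)[OF j(1)] P(1)[OF n(1)] P(1)[OF n'(1)]
    have m: "?m \<in> ?P" "?m' \<in> ?P" using j c by (simp_all add: positive_cone_def)
    have nm: "n \<otimes>\<^bsub>G\<^esub> ?m = j" "n' \<otimes>\<^bsub>G\<^esub> ?m' = j"
      using c by (simp_all add: G.m_assoc[symmetric])
    moreover have "x \<otimes>\<^bsub>G\<^esub> n \<otimes>\<^bsub>G\<^esub> ?m = x \<otimes>\<^bsub>G\<^esub> j" "x \<otimes>\<^bsub>G\<^esub> n' \<otimes>\<^bsub>G\<^esub> ?m' = x \<otimes>\<^bsub>G\<^esub> j"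
      using G.m_assoc[OF x c(2) P(1)[OF m(1)]] G.m_assoc[OF x c(3) P(1)[OF m(2)]] nm by simp_all
    ultimately show ?thesis
      using shift[OF x n m(1)] shift[OF x n' m(2)] by simp
  qed
  have F: "F x = p (x \<otimes>\<^bsub>G\<^esub> n) \<otimes>\<^bsub>G'\<^esub> inv\<^bsub>G'\<^esub> p n"
    if "x \<in> carrier G" "n \<in> ?P" "x \<otimes>\<^bsub>G\<^esub> n \<in> ?P" for x n
  proof -
    have "\<exists>n. n \<in> ?P \<and> x \<otimes>\<^bsub>G\<^esub> n \<in> ?P" using that by blast
    from someI_ex[OF this] show ?thesis
      unfolding F_def Let_def by (intro indep) (use that in simp_all)
  qed
  have ex: "\<exists>n\<in>?P. x \<otimes>\<^bsub>G\<^esub> n \<in> ?P \<and> y \<otimes>\<^bsub>G\<^esub> n \<in> ?P" if xy: "x \<in> carrier G" "y \<in> carrier G" for x y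
  proof -
    obtain n where n: "n \<in> ?P" "\<one>\<^bsub>G\<^esub> \<preceq>\<^bsub>G\<^esub> x \<otimes>\<^bsub>G\<^esub> n" "\<one>\<^bsub>G\<^esub> \<preceq>\<^bsub>G\<^esub> y \<otimes>\<^bsub>G\<^esub> n"
      using G.ex_common_bound[OF xy] by blast
    with xy P(1)[OF n(1)] show ?thesis by (intro bexI[of _ n]) (simp_all add: positive_cone_def)
  qed
  have F_closed: "F x \<in> carrier G'" if "x \<in> carrier G" for x
    using ex[OF that that] F[OF that] pc by fastforce
  have F_mult: "F (x \<otimes>\<^bsub>G\<^esub> y) = F x \<otimes>\<^bsub>G'\<^esub> F y" if x: "x \<in> carrier G" and y: "y \<in> carrier G" for x y
  proof -
    \<comment> \<open>The choice makes y + n a denominator for x, so that F x = p (x + y + n) - p (y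
      + n) and F y = p (y + n) - p n telescope.\<close>
    obtain n where n: "n \<in> ?P" "y \<otimes>\<^bsub>G\<^esub> n \<in> ?P" "x \<otimes>\<^bsub>G\<^esub> y \<otimes>\<^bsub>G\<^esub> n \<in> ?P"
      using ex[of y "x \<otimes>\<^bsub>G\<^esub> y"] x y by auto
    have xyn: "x \<otimes>\<^bsub>G\<^esub> (y \<otimes>\<^bsub>G\<^esub> n) = x \<otimes>\<^bsub>G\<^esub> y \<otimes>\<^bsub>G\<^esub> n" using x y n P by (simp add: G.m_assoc)
    show ?thesis
      using F[of "x \<otimes>\<^bsub>G\<^esub> y" n] F[of y n] F[of x "y \<otimes>\<^bsub>G\<^esub> n"] x y n pc[OF n(1)] pc[OF n(2)] pc[OF n(3)]
      by (simp add: xyn G'.m_assoc) (simp add: G'.m_assoc[symmetric])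
  qed
  have F_P: "F x = p x" if "x \<in> ?P" for x
    using F[of x "\<one>\<^bsub>G\<^esub>"] one that P p_one pc by simp
  have F_inj: "inj_on F (carrier G)"
  proof (rule inj_onI)
    fix x y assume x: "x \<in> carrier G" and y: "y \<in> carrier G" and eq: "F x = F y"
    obtain n where n: "n \<in> ?P" "x \<otimes>\<^bsub>G\<^esub> n \<in> ?P" "y \<otimes>\<^bsub>G\<^esub> n \<in> ?P" using ex[OF x y] by auto
    have "p (x \<otimes>\<^bsub>G\<^esub> n) = p (y \<otimes>\<^bsub>G\<^esub> n)"
      using eq F[OF x n(1,2)] F[OF y n(1,3)] pc n by simp
    then have "x \<otimes>\<^bsub>G\<^esub> n = y \<otimes>\<^bsub>G\<^esub> n" using bij n by (auto simp: bij_betw_def inj_on_def)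
    then show "x = y" using x y n P by simp
  qed
  interpret F: group_hom G G' F
    by unfold_locales (auto simp: hom_def F_closed F_mult)
  have F_surj: "F ` carrier G = carrier G'"
  proof
    show "carrier G' \<subseteq> F ` carrier G"
    proof
      fix y assume y: "y \<in> carrier G'"
      obtain n where n: "n \<in> ?P'" "y \<otimes>\<^bsub>G'\<^esub> n \<in> ?P'"
        using G'.ex_common_bound[OF y y] y by (auto simp: positive_cone_def)
      obtain a b where ab: "a \<in> ?P" "b \<in> ?P" "p a = y \<otimes>\<^bsub>G'\<^esub> n" "p b = n"
        using bij n unfolding bij_betw_def by (metis imageE)
      have "F (a \<otimes>\<^bsub>G\<^esub> inv\<^bsub>G\<^esub> b) = y"
        using ab P P' n y by (simp add: F_P G'.m_assoc)
      moreover have "a \<otimes>\<^bsub>G\<^esub> inv\<^bsub>G\<^esub> b \<in> carrier G" using P(1)[OF ab(1)] P(1)[OF ab(2)] by simp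
      ultimately show "y \<in> F ` carrier G" by blast
    qed
  qed (auto simp: F_closed)
  have pos: "\<one>\<^bsub>G\<^esub> \<preceq>\<^bsub>G\<^esub> x \<longleftrightarrow> \<one>\<^bsub>G'\<^esub> \<preceq>\<^bsub>G'\<^esub> F x" if x: "x \<in> carrier G" for x
  proof
    assume "\<one>\<^bsub>G'\<^esub> \<preceq>\<^bsub>G'\<^esub> F x"
    then have "F x \<in> p ` ?P" using bij F_closed[OF x] by (auto simp: bij_betw_def positive_cone_def)
    \<comment> \<open>A positive value of F is already attained on the positive cone, and
      injectivity identifies x with that positive preimage.\<close>
    then obtain q where "q \<in> ?P" "F x = F q" using F_P by auto
    then show "\<one>\<^bsub>G\<^esub> \<preceq>\<^bsub>G\<^esub> x" using F_inj x P by (metis inj_onD)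
  next
    assume "\<one>\<^bsub>G\<^esub> \<preceq>\<^bsub>G\<^esub> x"
    then have "x \<in> ?P" using x by (simp add: positive_cone_def)
    then show "\<one>\<^bsub>G'\<^esub> \<preceq>\<^bsub>G'\<^esub> F x" using F_P p P' by simp
  qed
  have "x \<preceq>\<^bsub>G\<^esub> y \<longleftrightarrow> F x \<preceq>\<^bsub>G'\<^esub> F y" if "x \<in> carrier G" "y \<in> carrier G" for x y
    using pos[of "y \<otimes>\<^bsub>G\<^esub> inv\<^bsub>G\<^esub> x"] that by (simp add: G.le_divide_iff G'.le_divide_iff)
  moreover have "F \<in> iso G G'"
    using F_inj F_surj F.homh by (auto simp: iso_def bij_betw_def)
  ultimately show ?thesis by (auto simp: l_group_isomorphic_def)
qed


section \<open>Lexicographic products\<close>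

lemma lex_prod_simps [simp]:
  "carrier (H \<times>\<^sub>l\<^sub>e\<^sub>x G) = carrier H \<times> carrier G"
  "(h, g) \<otimes>\<^bsub>H \<times>\<^sub>l\<^sub>e\<^sub>x G\<^esub> (h', g') = (h \<otimes>\<^bsub>H\<^esub> h', g \<otimes>\<^bsub>G\<^esub> g')"
  "\<one>\<^bsub>H \<times>\<^sub>l\<^sub>e\<^sub>x G\<^esub> = (\<one>\<^bsub>H\<^esub>, \<one>\<^bsub>G\<^esub>)"
  "(h, g) \<preceq>\<^bsub>H \<times>\<^sub>l\<^sub>e\<^sub>x G\<^esub> (h', g') \<longleftrightarrow> (h \<preceq>\<^bsub>H\<^esub> h' \<and> h \<noteq> h') \<or> (h = h' \<and> g \<preceq>\<^bsub>G\<^esub> g')"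
  by (simp_all add: lex_prod_def DirProd_def)

lemma group_lex_prod:
  assumes "group H" "group G"
  shows "group (H \<times>\<^sub>l\<^sub>e\<^sub>x G)"
proof -
  interpret H: group H by fact
  interpret G: group G by fact
  have "\<exists>y\<in>carrier (H \<times>\<^sub>l\<^sub>e\<^sub>x G). y \<otimes>\<^bsub>H \<times>\<^sub>l\<^sub>e\<^sub>x G\<^esub> x = \<one>\<^bsub>H \<times>\<^sub>l\<^sub>e\<^sub>x G\<^esub>"
    if "x \<in> carrier (H \<times>\<^sub>l\<^sub>e\<^sub>x G)" for x
    using that by (intro bexI[of _ "(inv\<^bsub>H\<^esub> fst x, inv\<^bsub>G\<^esub> snd x)"]) (cases x; simp)+
  then show ?thesis
    by (intro groupI) (auto simp: H.m_assoc G.m_assoc)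
qed

lemma inv_lex_prod:
  assumes "group H" "group G" "h \<in> carrier H" "g \<in> carrier G"
  shows "inv\<^bsub>H \<times>\<^sub>l\<^sub>e\<^sub>x G\<^esub> (h, g) = (inv\<^bsub>H\<^esub> h, inv\<^bsub>G\<^esub> g)"
proof -
  interpret H: group H by fact
  interpret G: group G by fact
  interpret L: group "H \<times>\<^sub>l\<^sub>e\<^sub>x G" using assms by (intro group_lex_prod)
  show ?thesis using assms by (intro L.inv_equality) auto
qed

lemma pow_lex_prod:
  "(h, g) [^]\<^bsub>H \<times>\<^sub>l\<^sub>e\<^sub>x G\<^esub> (n::nat) = (h [^]\<^bsub>H\<^esub> n, g [^]\<^bsub>G\<^esub> n)"
  by (induction n) (simp_all add: nat_pow_def)

text \<open>Totality of \<open>H\<close> makes meets explicit: the pair with the smaller first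
  coordinate is the meet, and equal first coordinates leave only a meet in \<open>G\<close>.\<close>

lemma l_group_lex_prod:
  assumes "l_group H" "total_order (order_of H)" "l_group G"
  shows "l_group (H \<times>\<^sub>l\<^sub>e\<^sub>x G)"
proof -
  interpret H: l_group H by fact
  interpret G: l_group G by fact
  have total: "x \<preceq>\<^bsub>H\<^esub> y \<or> y \<preceq>\<^bsub>H\<^esub> x" if "x \<in> carrier H" "y \<in> carrier H" for x y
    using total_order.total_order_total[OF assms(2)] that by simp
  show ?thesis
  proof (rule l_groupI)
    show "group (H \<times>\<^sub>l\<^sub>e\<^sub>x G)"
      by (intro group_lex_prod H.group_axioms G.group_axioms)
  next
    fix x assume "x \<in> carrier (H \<times>\<^sub>l\<^sub>e\<^sub>x G)"
    then show "x \<preceq>\<^bsub>H \<times>\<^sub>l\<^sub>e\<^sub>x G\<^esub> x" by (cases x) (simp add: G.po_refl)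
  next
    fix x y assume "x \<preceq>\<^bsub>H \<times>\<^sub>l\<^sub>e\<^sub>x G\<^esub> y" "y \<preceq>\<^bsub>H \<times>\<^sub>l\<^sub>e\<^sub>x G\<^esub> x"
      "x \<in> carrier (H \<times>\<^sub>l\<^sub>e\<^sub>x G)" "y \<in> carrier (H \<times>\<^sub>l\<^sub>e\<^sub>x G)"
    then show "x = y"
      by (cases x, cases y) (auto dest: H.po_antisym G.po_antisym)
  next
    fix x y z assume "x \<preceq>\<^bsub>H \<times>\<^sub>l\<^sub>e\<^sub>x G\<^esub> y" "y \<preceq>\<^bsub>H \<times>\<^sub>l\<^sub>e\<^sub>x G\<^esub> z"
      "x \<in> carrier (H \<times>\<^sub>l\<^sub>e\<^sub>x G)" "y \<in> carrier (H \<times>\<^sub>l\<^sub>e\<^sub>x G)" "z \<in> carrier (H \<times>\<^sub>l\<^sub>e\<^sub>x G)"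
    then show "x \<preceq>\<^bsub>H \<times>\<^sub>l\<^sub>e\<^sub>x G\<^esub> z"
      using H.po_trans[of "fst x" "fst y" "fst z"] G.po_trans[of "snd x" "snd y" "snd z"]
        H.po_antisym[of "fst x" "fst y"]
      by (cases x, cases y, cases z) auto
  next
    fix x y a b assume "x \<in> carrier (H \<times>\<^sub>l\<^sub>e\<^sub>x G)" "y \<in> carrier (H \<times>\<^sub>l\<^sub>e\<^sub>x G)"
      "a \<in> carrier (H \<times>\<^sub>l\<^sub>e\<^sub>x G)" "b \<in> carrier (H \<times>\<^sub>l\<^sub>e\<^sub>x G)" "x \<preceq>\<^bsub>H \<times>\<^sub>l\<^sub>e\<^sub>x G\<^esub> y"
    then show "a \<otimes>\<^bsub>H \<times>\<^sub>l\<^sub>e\<^sub>x G\<^esub> x \<otimes>\<^bsub>H \<times>\<^sub>l\<^sub>e\<^sub>x G\<^esub> b \<preceq>\<^bsub>H \<times>\<^sub>l\<^sub>e\<^sub>x G\<^esub> a \<otimes>\<^bsub>H \<times>\<^sub>l\<^sub>e\<^sub>x G\<^esub> y \<otimes>\<^bsub>H \<times>\<^sub>l\<^sub>e\<^sub>x G\<^esub> b"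
      by (cases x, cases y, cases a, cases b) (auto intro: H.translation G.translation)
  next
    fix x y assume "x \<in> carrier (H \<times>\<^sub>l\<^sub>e\<^sub>x G)" "y \<in> carrier (H \<times>\<^sub>l\<^sub>e\<^sub>x G)"
    then obtain h g h' g' where xy: "x = (h, g)" "y = (h', g')"
      and c: "h \<in> carrier H" "g \<in> carrier G" "h' \<in> carrier H" "g' \<in> carrier G"
      by (cases x, cases y) auto
    define m where "m = (if h = h' then (h, g \<sqinter>\<^bsub>order_of G\<^esub> g') else if h \<preceq>\<^bsub>H\<^esub> h' then x else y)"
    have "m \<in> carrier (H \<times>\<^sub>l\<^sub>e\<^sub>x G)" "m \<preceq>\<^bsub>H \<times>\<^sub>l\<^sub>e\<^sub>x G\<^esub> x" "m \<preceq>\<^bsub>H \<times>\<^sub>l\<^sub>e\<^sub>x G\<^esub> y"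
      using c total[of h h'] by (auto simp: m_def xy G.po_refl G.inf_left G.inf_right)
    moreover have "z \<preceq>\<^bsub>H \<times>\<^sub>l\<^sub>e\<^sub>x G\<^esub> m"
      if "z \<in> carrier (H \<times>\<^sub>l\<^sub>e\<^sub>x G)" "z \<preceq>\<^bsub>H \<times>\<^sub>l\<^sub>e\<^sub>x G\<^esub> x" "z \<preceq>\<^bsub>H \<times>\<^sub>l\<^sub>e\<^sub>x G\<^esub> y" for z
      using that c by (cases z) (auto simp: m_def xy intro: G.inf_greatest)
    ultimately show "\<exists>m\<in>carrier (H \<times>\<^sub>l\<^sub>e\<^sub>x G). m \<preceq>\<^bsub>H \<times>\<^sub>l\<^sub>e\<^sub>x G\<^esub> x \<and> m \<preceq>\<^bsub>H \<times>\<^sub>l\<^sub>e\<^sub>x G\<^esub> y \<and>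
        (\<forall>z\<in>carrier (H \<times>\<^sub>l\<^sub>e\<^sub>x G). z \<preceq>\<^bsub>H \<times>\<^sub>l\<^sub>e\<^sub>x G\<^esub> x \<longrightarrow> z \<preceq>\<^bsub>H \<times>\<^sub>l\<^sub>e\<^sub>x G\<^esub> y \<longrightarrow> z \<preceq>\<^bsub>H \<times>\<^sub>l\<^sub>e\<^sub>x G\<^esub> m)"
      by blast
  qed
qed

lemma unital_lex_prod:
  assumes "unital_l_group H u" "total_order (order_of H)" "l_group G" "u \<noteq> \<one>\<^bsub>H\<^esub>"
  shows "unital_l_group (H \<times>\<^sub>l\<^sub>e\<^sub>x G) (u, \<one>\<^bsub>G\<^esub>)"
proof -
  interpret H: unital_l_group H u by fact
  interpret G: l_group G by fact
  interpret L: l_group "H \<times>\<^sub>l\<^sub>e\<^sub>x G"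
    using assms H.l_group_axioms by (intro l_group_lex_prod)
  show ?thesis
  proof
    show "(u, \<one>\<^bsub>G\<^esub>) \<in> carrier (H \<times>\<^sub>l\<^sub>e\<^sub>x G)" by (simp add: H.unit_closed)
    show "\<one>\<^bsub>H \<times>\<^sub>l\<^sub>e\<^sub>x G\<^esub> \<preceq>\<^bsub>H \<times>\<^sub>l\<^sub>e\<^sub>x G\<^esub> (u, \<one>\<^bsub>G\<^esub>)" using H.unit_nonneg assms(4) by auto
    fix x assume "x \<in> carrier (H \<times>\<^sub>l\<^sub>e\<^sub>x G)"
    then obtain h g where x: "x = (h, g)" "h \<in> carrier H" "g \<in> carrier G" by auto
    obtain n :: nat where n: "inv\<^bsub>H\<^esub> (u [^]\<^bsub>H\<^esub> n) \<preceq>\<^bsub>H\<^esub> h" "h \<preceq>\<^bsub>H\<^esub> u [^]\<^bsub>H\<^esub> n"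
      using H.strong_unit[OF x(2)] by auto
    \<comment> \<open>The bounds by n copies of u may be attained, and then the second coordinate
      would matter. One further copy makes both bounds strict.\<close>
    let ?v = "u [^]\<^bsub>H\<^esub> n" and ?v' = "u [^]\<^bsub>H\<^esub> Suc n"
    have v: "?v \<in> carrier H" "?v' \<in> carrier H" using H.unit_closed by auto
    have lt: "?v \<preceq>\<^bsub>H\<^esub> ?v'" "?v \<noteq> ?v'"
      using H.le_mult_right[of ?v u] H.unit_closed H.unit_nonneg v(1) assms(4) by auto
    have "h \<preceq>\<^bsub>H\<^esub> ?v'" "h \<noteq> ?v'"
      using H.po_trans[OF n(2) lt(1) x(2) v] H.po_antisym[OF lt(1) _ v] n(2) lt(2) by blast+
    moreover have "inv\<^bsub>H\<^esub> ?v' \<preceq>\<^bsub>H\<^esub> inv\<^bsub>H\<^esub> ?v" "inv\<^bsub>H\<^esub> ?v' \<noteq> inv\<^bsub>H\<^esub> ?v"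
      using lt v H.inv_antimono_iff[OF v(2,1)] by (auto dest: H.inv_inj[THEN inj_onD])
    then have "inv\<^bsub>H\<^esub> ?v' \<preceq>\<^bsub>H\<^esub> h" "inv\<^bsub>H\<^esub> ?v' \<noteq> h"
      using H.po_trans[of "inv\<^bsub>H\<^esub> ?v'" "inv\<^bsub>H\<^esub> ?v" h] H.po_antisym[of "inv\<^bsub>H\<^esub> ?v'" "inv\<^bsub>H\<^esub> ?v"]
        n(1) v x(2) by (blast intro: H.inv_closed)+
    ultimately show "\<exists>n::nat. inv\<^bsub>H \<times>\<^sub>l\<^sub>e\<^sub>x G\<^esub> ((u, \<one>\<^bsub>G\<^esub>) [^]\<^bsub>H \<times>\<^sub>l\<^sub>e\<^sub>x G\<^esub> n) \<preceq>\<^bsub>H \<times>\<^sub>l\<^sub>e\<^sub>x G\<^esub> x \<and>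
        x \<preceq>\<^bsub>H \<times>\<^sub>l\<^sub>e\<^sub>x G\<^esub> (u, \<one>\<^bsub>G\<^esub>) [^]\<^bsub>H \<times>\<^sub>l\<^sub>e\<^sub>x G\<^esub> n"
      using v x(1)
      by (intro exI[of _ "Suc n"])
        (simp del: nat_pow_Suc add: pow_lex_prod inv_lex_prod H.group_axioms G.group_axioms)
  qed
qed

text \<open>If \<open>u = 0\<close>, then \<open>G\<close> is trivial because \<open>(u, 0)\<close> is a strong unit.\<close>

lemma bottom_le_unit:
  assumes "unital_l_group H u" "unital_l_group (H \<times>\<^sub>l\<^sub>e\<^sub>x G) (u, \<one>\<^bsub>G\<^esub>)" "g \<in> carrier G" "group G"
  shows "(\<one>\<^bsub>H\<^esub>, g) \<preceq>\<^bsub>H \<times>\<^sub>l\<^sub>e\<^sub>x G\<^esub> (u, \<one>\<^bsub>G\<^esub>)"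
proof -
  interpret H: unital_l_group H u by fact
  interpret G: group G by fact
  interpret L: unital_l_group "H \<times>\<^sub>l\<^sub>e\<^sub>x G" "(u, \<one>\<^bsub>G\<^esub>)" by fact
  show ?thesis
  proof (cases "u = \<one>\<^bsub>H\<^esub>")
    case True
    then show ?thesis using L.strong_unit[of "(\<one>\<^bsub>H\<^esub>, g)"] assms(3) by (auto simp: pow_lex_prod)
  next
    case False
    then show ?thesis using H.unit_nonneg by auto
  qed
qed

text \<open>The unit cuts off no positive element of \<open>G\<close>, so the bottom component
  retains the full positive cone and not merely an interval of it.\<close>

lemma bottom_component_eq:
  assumes "unital_l_group H u" "unital_l_group (H \<times>\<^sub>l\<^sub>e\<^sub>x G) (u, \<one>\<^bsub>G\<^esub>)" "group G"
  shows "bottom_component H u G = {\<one>\<^bsub>H\<^esub>} \<times> positive_cone G"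
proof -
  interpret H: unital_l_group H u by fact
  show ?thesis
    using bottom_le_unit[OF assms(1,2) _ assms(3)]
    by (fastforce simp: bottom_component_def Gamma_def interval_def positive_cone_def)
qed

section \<open>Isomorphisms of pseudo MV-algebras\<close>

lemma pseudo_mv_iso_comp:
  assumes "f \<in> pseudo_mv_iso M N" "g \<in> pseudo_mv_iso N L"
  shows "g \<circ> f \<in> pseudo_mv_iso M L"
proof -
  have "f x \<in> carrier N" if "x \<in> carrier M" for x
    using assms(1) that by (auto simp: pseudo_mv_iso_def bij_betw_def)
  then show ?thesis
    using assms by (auto simp: pseudo_mv_iso_def intro: bij_betw_trans)
qed

lemma (in pseudo_mv_algebra) pseudo_mv_iso_inv:
  assumes f: "f \<in> pseudo_mv_iso M N"
  shows "inv_into (carrier M) f \<in> pseudo_mv_iso N M"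
proof -
  let ?g = "inv_into (carrier M) f"
  have bij: "bij_betw f (carrier M) (carrier N)" using f by (simp add: pseudo_mv_iso_def)
  have g: "?g y \<in> carrier M" "f (?g y) = y" if "y \<in> carrier N" for y
    using bij that by (auto simp: bij_betw_def intro: inv_into_into f_inv_into_f)
  have eq: "?g y = x" if "x \<in> carrier M" "f x = y" for x y
    using bij that by (auto simp: bij_betw_def)
  show ?thesis
    unfolding pseudo_mv_iso_def
  proof (intro CollectI conjI ballI)
    show "bij_betw ?g (carrier N) (carrier M)" using bij by (rule bij_betw_inv_into)
  qed (use f g in \<open>auto simp: pseudo_mv_iso_def intro!: eq mplus_closed lneg_closed rneg_closed mzero_closed mone_closed\<close>)
qed


section \<open>Decompositions with a central section\<close>

text \<open>This is the strong perfect structure moved into the ambient group \<open>K\<close>,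
  where subtraction is available. The section \<open>k\<close> is multiplicative for the group
  operation itself, not just for truncated sums.\<close>

locale central_decomposition =
  K: unital_l_group K w + H: unital_l_group H u + H: comm_group H
  for K :: "('k, 'd) po_group_scheme" (structure) and w
    and H :: "('h, 'b) po_group_scheme" and u +
  fixes E :: "'h \<Rightarrow> 'k set" and k :: "'h \<Rightarrow> 'k"
  assumes H_order: "total_order (order_of H)"
    and E_union: "(\<Union>t\<in>interval H u. E t) = interval K w"
    and E_disjoint: "\<lbrakk>s \<in> interval H u; t \<in> interval H u; x \<in> E s; x \<in> E t\<rbrakk> \<Longrightarrow> s = t"
    and E_ordered: "\<lbrakk>s \<in> interval H u; t \<in> interval H u; s \<preceq>\<^bsub>H\<^esub> t; s \<noteq> t; a \<in> E s; b \<in> E t\<rbrakk>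
      \<Longrightarrow> a \<preceq> b"
    and E_neg: "\<lbrakk>t \<in> interval H u; x \<in> E t\<rbrakk> \<Longrightarrow> w \<otimes> inv x \<in> E (u \<otimes>\<^bsub>H\<^esub> inv\<^bsub>H\<^esub> t)"
    and E_plus: "\<lbrakk>s \<in> interval H u; t \<in> interval H u; x \<in> E s; y \<in> E t\<rbrakk>
      \<Longrightarrow> (x \<otimes> y) \<sqinter>\<^bsub>order_of K\<^esub> w \<in> E (if s \<otimes>\<^bsub>H\<^esub> t \<preceq>\<^bsub>H\<^esub> u then s \<otimes>\<^bsub>H\<^esub> t else u)"
    and k_in: "t \<in> interval H u \<Longrightarrow> k t \<in> E t"
    and k_central: "\<lbrakk>t \<in> interval H u; x \<in> carrier K\<rbrakk> \<Longrightarrow> k t \<otimes> x = x \<otimes> k t"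
    and k_mult: "\<lbrakk>s \<in> interval H u; t \<in> interval H u; s \<otimes>\<^bsub>H\<^esub> t \<preceq>\<^bsub>H\<^esub> u\<rbrakk>
      \<Longrightarrow> k (s \<otimes>\<^bsub>H\<^esub> t) = k s \<otimes> k t"
    and k_unit: "k u = w"
begin

section \<open>Arithmetic of indices\<close>

lemma H_total: "\<lbrakk>s \<in> carrier H; t \<in> carrier H\<rbrakk> \<Longrightarrow> s \<preceq>\<^bsub>H\<^esub> t \<or> t \<preceq>\<^bsub>H\<^esub> s"
  using total_order.total_order_total[OF H_order] by simp

lemma H_interval:
  assumes "t \<in> interval H u"
  shows "t \<in> carrier H" "\<one>\<^bsub>H\<^esub> \<preceq>\<^bsub>H\<^esub> t" "t \<preceq>\<^bsub>H\<^esub> u"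
  using assms by (simp_all add: interval_def)

lemma one_in_interval: "\<one>\<^bsub>H\<^esub> \<in> interval H u"
  by (simp add: interval_def H.po_refl H.unit_nonneg)

lemma unit_in_interval: "u \<in> interval H u"
  by (simp add: interval_def H.po_refl H.unit_nonneg H.unit_closed)

lemma complement_in_interval: "t \<in> interval H u \<Longrightarrow> u \<otimes>\<^bsub>H\<^esub> inv\<^bsub>H\<^esub> t \<in> interval H u"
  using H.unit_closed by (auto simp: interval_def H.le_divide_iff H.divide_le_iff intro: H.le_mult_right)

lemma mult_in_interval:
  "\<lbrakk>s \<in> interval H u; t \<in> interval H u; s \<otimes>\<^bsub>H\<^esub> t \<preceq>\<^bsub>H\<^esub> u\<rbrakk> \<Longrightarrow> s \<otimes>\<^bsub>H\<^esub> t \<in> interval H u"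
  by (auto simp: interval_def intro: H.one_le_mult)

lemma E_mem:
  assumes "t \<in> interval H u" "x \<in> E t"
  shows "x \<in> carrier K" "\<one> \<preceq> x" "x \<preceq> w"
  using E_union assms by (auto simp: interval_def)

lemma k_closed: "t \<in> interval H u \<Longrightarrow> k t \<in> carrier K"
  using E_mem k_in by blast

text \<open>The unit is the value \<open>k u\<close> of the central section. Consequently w - x and
  -x + w coincide.\<close>

lemma w_central: "x \<in> carrier K \<Longrightarrow> w \<otimes> x = x \<otimes> w"
  using k_central[OF unit_in_interval] k_unit by simp

lemma inv_w_comm: "x \<in> carrier K \<Longrightarrow> inv x \<otimes> w = w \<otimes> inv x"
  using w_central[of "inv x"] by simp

lemma k_one: "k \<one>\<^bsub>H\<^esub> = \<one>"
  using k_mult[OF one_in_interval one_in_interval] k_closed[OF one_in_interval] H.unit_nonneg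
  by simp

lemma one_in_E: "\<one> \<in> E \<one>\<^bsub>H\<^esub>"
  using k_in[OF one_in_interval] k_one by simp

text \<open>Here \<open>w\<close> is both \<open>k u\<close> and \<open>k\<close> at 0, hence 0, and
  a vanishing strong unit bounds every element by 0 from both sides. This settles the case in which
  the indices 0 and u are not separated.\<close>

lemma trivial_unit:
  assumes "u = \<one>\<^bsub>H\<^esub>"
  shows "w = \<one>" "carrier K = {\<one>}"
proof -
  show w: "w = \<one>" using k_one k_unit assms by simp
  have "x = \<one>" if "x \<in> carrier K" for x
    using K.strong_unit[OF that] that w by (auto intro: K.po_antisym)
  then show "carrier K = {\<one>}" by auto
qed

text \<open>Totality of \<open>H\<close> turns \<open>E_ordered\<close> around: a strictly larger
  index s would put b below a, so a = b would lie in two different parts.\<close>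

lemma E_index_mono:
  assumes s: "s \<in> interval H u" and t: "t \<in> interval H u" and ab: "a \<in> E s" "b \<in> E t" "a \<preceq> b"
  shows "s \<preceq>\<^bsub>H\<^esub> t"
proof (rule ccontr)
  assume "\<not> s \<preceq>\<^bsub>H\<^esub> t"
  moreover have "t \<preceq>\<^bsub>H\<^esub> s" using H_total H_interval(1)[OF s] H_interval(1)[OF t] calculation by blast
  ultimately have "b \<preceq> a" using E_ordered[OF t s, of b a] ab H.po_refl[OF H_interval(1)[OF t]] by blast
  then have "a = b" using ab E_mem[OF s] E_mem[OF t] by (auto intro: K.po_antisym)
  then show False
    using E_disjoint[OF s t] ab \<open>\<not> s \<preceq>\<^bsub>H\<^esub> t\<close> H.po_refl[OF H_interval(1)[OF t]] by blast
qed

text \<open>The bound by \<open>w\<close> says that a lies below w - b, and the index u - t of w - b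
  is strictly larger than s. The truncated sum of \<open>E_plus\<close> is then the group
  sum.\<close>

lemma E_mult_small:
  assumes s: "s \<in> interval H u" and t: "t \<in> interval H u" and ab: "a \<in> E s" "b \<in> E t"
    and st: "s \<otimes>\<^bsub>H\<^esub> t \<preceq>\<^bsub>H\<^esub> u" "s \<otimes>\<^bsub>H\<^esub> t \<noteq> u"
  shows "a \<otimes> b \<preceq> w" "a \<otimes> b \<in> E (s \<otimes>\<^bsub>H\<^esub> t)"
proof -
  note c = E_mem(1)[OF s ab(1)] E_mem(1)[OF t ab(2)] H_interval(1)[OF s] H_interval(1)[OF t]
  have "s \<preceq>\<^bsub>H\<^esub> u \<otimes>\<^bsub>H\<^esub> inv\<^bsub>H\<^esub> t" "s \<noteq> u \<otimes>\<^bsub>H\<^esub> inv\<^bsub>H\<^esub> t"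
    using st c H.unit_closed by (auto simp: H.le_divide_iff H.m_assoc)
  then have "a \<preceq> w \<otimes> inv b"
    using E_ordered[OF s complement_in_interval[OF t]] E_neg[OF t] ab by blast
  then show le: "a \<otimes> b \<preceq> w" using c K.unit_closed by (simp add: K.le_divide_iff)
  show "a \<otimes> b \<in> E (s \<otimes>\<^bsub>H\<^esub> t)"
    using E_plus[OF s t ab] st c K.unit_closed le by (simp add: K.inf_absorb1)
qed

text \<open>Mirror image of the preceding argument: u - t is now strictly below s. When s + t = u,
  the elements a and w - b share an index, and nothing can be said about their order.\<close>

lemma E_mult_large:
  assumes s: "s \<in> interval H u" and t: "t \<in> interval H u" and ab: "a \<in> E s" "b \<in> E t"
    and st: "\<not> s \<otimes>\<^bsub>H\<^esub> t \<preceq>\<^bsub>H\<^esub> u"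
  shows "w \<preceq> a \<otimes> b"
proof -
  note c = E_mem(1)[OF s ab(1)] E_mem(1)[OF t ab(2)] H_interval(1)[OF s] H_interval(1)[OF t]
  have le: "\<not> s \<preceq>\<^bsub>H\<^esub> u \<otimes>\<^bsub>H\<^esub> inv\<^bsub>H\<^esub> t"
    using st c H.unit_closed by (simp add: H.le_divide_iff)
  moreover have "u \<otimes>\<^bsub>H\<^esub> inv\<^bsub>H\<^esub> t \<preceq>\<^bsub>H\<^esub> s"
    using H_total[of s "u \<otimes>\<^bsub>H\<^esub> inv\<^bsub>H\<^esub> t"] le c H.unit_closed by simp
  ultimately have "w \<otimes> inv b \<preceq> a"
    using E_ordered[OF complement_in_interval[OF t] s] E_neg[OF t] ab H.po_refl[OF c(3)] by metis
  then show ?thesis using c K.unit_closed by (simp add: K.divide_le_iff)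
qed

lemma E_one_mult:
  assumes "a \<in> E \<one>\<^bsub>H\<^esub>" "b \<in> E \<one>\<^bsub>H\<^esub>"
  shows "a \<otimes> b \<in> E \<one>\<^bsub>H\<^esub>"
proof (cases "u = \<one>\<^bsub>H\<^esub>")
  case True
  then have "a = \<one>" "b = \<one>" using trivial_unit(2) E_mem(1)[OF one_in_interval] assms by auto
  then show ?thesis using one_in_E by simp
next
  case False
  then show ?thesis
    using E_mult_small(2)[OF one_in_interval one_in_interval assms] H.unit_nonneg by simp
qed

lemma E_one_downset:
  assumes a: "a \<in> carrier K" "\<one> \<preceq> a" "a \<preceq> b" and b: "b \<in> E \<one>\<^bsub>H\<^esub>"
  shows "a \<in> E \<one>\<^bsub>H\<^esub>"
proof -
  have "a \<in> interval K w"
    using a K.po_trans[OF a(3) E_mem(3)[OF one_in_interval b]] E_mem(1)[OF one_in_interval b] K.unit_closed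
    by (simp add: interval_def)
  then obtain s where s: "s \<in> interval H u" "a \<in> E s" using E_union by auto
  then have "s \<preceq>\<^bsub>H\<^esub> \<one>\<^bsub>H\<^esub>" using E_index_mono[OF s(1) one_in_interval s(2) b a(3)] by simp
  then have "s = \<one>\<^bsub>H\<^esub>" using H_interval[OF s(1)] by (auto intro: H.po_antisym)
  then show ?thesis using s by simp
qed

text \<open>An element of \<open>E t\<close> is below \<open>w\<close>, so truncation leaves a + b
  unchanged, and \<open>E_plus\<close> gives it the index s + q or, on overflow, u. Excluding t = u
  removes the second possibility.\<close>

lemma E_factor:
  assumes s: "s \<in> interval H u" and t: "t \<in> interval H u" and q: "q \<in> interval H u"
    and a: "a \<in> E s" and b: "b \<in> E q" and ab: "a \<otimes> b \<in> E t"
    and "t \<noteq> u"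
  shows "s \<otimes>\<^bsub>H\<^esub> q = t"
proof -
  have "(a \<otimes> b) \<sqinter>\<^bsub>order_of K\<^esub> w = a \<otimes> b"
    using E_mem[OF t ab] K.unit_closed by (simp add: K.inf_absorb1)
  then have "a \<otimes> b \<in> E (if s \<otimes>\<^bsub>H\<^esub> q \<preceq>\<^bsub>H\<^esub> u then s \<otimes>\<^bsub>H\<^esub> q else u)"
    using E_plus[OF s q a b] by simp
  then show ?thesis
    using E_disjoint[OF _ t _ ab] mult_in_interval[OF s q] unit_in_interval \<open>t \<noteq> u\<close>
    by (metis (full_types))
qed

text \<open>
  Let \<open>a\<close> and \<open>b\<close> be the quotients of \<open>x\<close> and \<open>k t\<close> by their meet. They are orthogonal and have the
  same index \<open>s\<close>. If \<open>s > 0\<close>, then \<open>b\<close> lies below \<open>2a\<close>, whose index exceeds \<open>s\<close>, so \<open>b = 0\<close>,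
  which has index \<open>0\<close>.
\<close>

lemma E_divide_section:
  assumes t: "t \<in> interval H u" and x: "x \<in> E t"
  shows "\<exists>a\<in>E \<one>\<^bsub>H\<^esub>. \<exists>b\<in>E \<one>\<^bsub>H\<^esub>. inv b \<preceq> x \<otimes> inv k t \<and> x \<otimes> inv k t \<preceq> a"
proof (cases "t = u")
  case True
  note xc = E_mem[OF t x]
  \<comment> \<open>Indices do not subtract at the top. There x - w is the negative of w - x, and w
    - x has index 0.\<close>
  have "w \<otimes> inv x \<in> E \<one>\<^bsub>H\<^esub>" using E_neg[OF t x] True H.unit_closed by simp
  moreover have "inv (w \<otimes> inv x) = x \<otimes> inv w"
    using xc K.unit_closed by (simp add: K.inv_mult_group)
  moreover have "x \<otimes> inv w \<preceq> \<one>" using xc K.unit_closed by (simp add: K.divide_le_iff)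
  moreover have "x \<otimes> inv w \<in> carrier K" using xc K.unit_closed by simp
  ultimately show ?thesis
    using one_in_E K.po_refl True k_unit by (intro bexI[of _ \<one>] bexI[of _ "w \<otimes> inv x"]) auto
next
  case False
  define z where "z = k t"
  have z: "z \<in> carrier K" "\<one> \<preceq> z" "z \<preceq> w" "z \<in> E t"
    using E_mem[OF t k_in[OF t]] k_in[OF t] by (auto simp: z_def)
  note xc = E_mem[OF t x]
  define m where "m = x \<sqinter>\<^bsub>order_of K\<^esub> z"
  have m: "m \<in> carrier K" "m \<preceq> x" "m \<preceq> z" "\<one> \<preceq> m"
    using xc z by (auto simp: m_def intro: K.inf_left K.inf_right K.inf_greatest)
  have mw: "m \<preceq> w" using K.po_trans[OF m(2) xc(3)] m xc K.unit_closed by simp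
  define a b where "a = x \<otimes> inv m" and "b = z \<otimes> inv m"
  have a: "a \<in> carrier K" "\<one> \<preceq> a" "a \<otimes> m = x"
    using xc m by (auto simp: a_def K.le_divide_iff K.m_assoc)
  have b: "b \<in> carrier K" "\<one> \<preceq> b" "b \<otimes> m = z"
    using z m by (auto simp: b_def K.le_divide_iff K.m_assoc)
  have "a \<preceq> x" "b \<preceq> z"
    using K.le_mult_right[of a m] K.le_mult_right[of b m] a b m by auto
  then have "a \<preceq> w" "b \<preceq> w"
    using K.po_trans[of a x w] K.po_trans[of b z w] a b xc z K.unit_closed by auto
  then have "a \<in> interval K w" "b \<in> interval K w" "m \<in> interval K w"
    using a b m mw by (auto simp: interval_def)
  then obtain s s' q where s: "s \<in> interval H u" "a \<in> E s" and s': "s' \<in> interval H u" "b \<in> E s'"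
    and q: "q \<in> interval H u" "m \<in> E q"
    using E_union by blast
  \<comment> \<open>Adding m to a and to b leads to x and z, both of index t, so the index q of m
    can be cancelled.\<close>
  have sq: "s \<otimes>\<^bsub>H\<^esub> q = t" using E_factor[OF s(1) t q(1) s(2) q(2)] a x False by simp
  have s'q: "s' \<otimes>\<^bsub>H\<^esub> q = t" using E_factor[OF s'(1) t q(1) s'(2) q(2)] b z False by simp
  have ss': "s' = s" using sq s'q H_interval(1) s(1) s'(1) q(1) by (metis H.right_cancel)
  have orth: "a \<sqinter>\<^bsub>order_of K\<^esub> b = \<one>"
    using K.inf_mult_right[of x z "inv m"] xc z m by (simp add: a_def b_def m_def[symmetric])
  have s_one: "s = \<one>\<^bsub>H\<^esub>"
  proof (rule ccontr)
    assume ne: "s \<noteq> \<one>\<^bsub>H\<^esub>"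
    note sc = H_interval[OF s(1)] and qc = H_interval[OF q(1)] and tc = H_interval[OF t]
    have "s \<noteq> u"
    proof
      assume "s = u"
      then have "u \<preceq>\<^bsub>H\<^esub> t" using H.le_mult_right[of s q] sc qc sq by simp
      then show False using tc False H.unit_closed by (auto dest: H.po_antisym)
    qed
    \<comment> \<open>The index of the truncated double of a; it lies strictly above s because s is
      neither 0 nor u.\<close>
    define r where "r = (if s \<otimes>\<^bsub>H\<^esub> s \<preceq>\<^bsub>H\<^esub> u then s \<otimes>\<^bsub>H\<^esub> s else u)"
    have r: "r \<in> interval H u" using mult_in_interval[OF s(1) s(1)] unit_in_interval by (simp add: r_def)
    have "s \<preceq>\<^bsub>H\<^esub> r" "s \<noteq> r"
      using sc H.le_mult_right[of s s] ne \<open>s \<noteq> u\<close> by (auto simp: r_def)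
    then have "b \<preceq> (a \<otimes> a) \<sqinter>\<^bsub>order_of K\<^esub> w"
      using E_ordered[OF s(1) r] s' ss' E_plus[OF s(1) s(1) s(2) s(2)] by (auto simp: r_def)
    then have "b \<preceq> a \<otimes> a"
      using K.inf_left[of "a \<otimes> a" w] K.po_trans[of b "(a \<otimes> a) \<sqinter>\<^bsub>order_of K\<^esub> w" "a \<otimes> a"] a b K.unit_closed
      by simp
    then have "b = \<one>"
      using K.orthogonal_dominated[OF a(1) b(1) a(2) orth] b by (auto intro: K.po_antisym)
    then show False using E_disjoint[OF s(1) one_in_interval, of b] s' ss' one_in_E ne by simp
  qed
  \<comment> \<open>As m lies below x and below z, the difference x - z is at least m - z = -b and
    at most x - m = a.\<close>
  have "inv b \<preceq> x \<otimes> inv z"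
    using m xc z by (simp add: b_def K.inv_mult_group K.mult_right_mono)
  moreover have "x \<otimes> inv z \<preceq> a"
    using K.mult_left_mono[of m z a] a m z xc by (simp add: K.divide_le_iff)
  ultimately show ?thesis using s s' ss' s_one z_def by blast
qed

section \<open>The convex subgroup around the bottom part\<close>

definition core_carrier :: "'k set" where
  "core_carrier = {g \<in> carrier K. \<exists>a\<in>E \<one>\<^bsub>H\<^esub>. \<exists>b\<in>E \<one>\<^bsub>H\<^esub>. inv b \<preceq> g \<and> g \<preceq> a}"

text \<open>Shrinking the carrier keeps the operations, the order and the element type of
  \<open>K\<close>, so the group to be exhibited has the type that the existence claim asks
  for.\<close>

definition core :: "('k, 'd) po_group_scheme" where
  "core = K\<lparr>carrier := core_carrier\<rparr>"

lemma core_simps [simp]: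
  "carrier core = core_carrier" "mult core = mult K" "one core = one K" "gle core = gle K"
  by (simp_all add: core_def)

lemma E_one_closed: "a \<in> E \<one>\<^bsub>H\<^esub> \<Longrightarrow> a \<in> carrier K"
  using E_mem(1)[OF one_in_interval] .

lemma core_closed: "g \<in> core_carrier \<Longrightarrow> g \<in> carrier K"
  by (simp add: core_carrier_def)

lemma core_subgroup: "subgroup core_carrier K"
proof (rule K.subgroupI)
  show "core_carrier \<subseteq> carrier K" by (auto simp: core_carrier_def)
  have "\<one> \<in> core_carrier"
    using one_in_E K.po_refl by (auto simp: core_carrier_def intro!: bexI[of _ \<one>])
  then show "core_carrier \<noteq> {}" by blast
next
  fix g assume "g \<in> core_carrier"
  then obtain a b where g: "g \<in> carrier K" "a \<in> E \<one>\<^bsub>H\<^esub>" "b \<in> E \<one>\<^bsub>H\<^esub>" "inv b \<preceq> g" "g \<preceq> a"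
    by (auto simp: core_carrier_def)
  note c = E_one_closed[OF g(2)] E_one_closed[OF g(3)]
  have "inv a \<preceq> inv g" "inv g \<preceq> b"
    using g c K.inv_antimono_iff[of "inv b" g] K.inv_antimono_iff[of a g]
      K.inv_antimono_iff[of g "inv b"] by auto
  then show "inv g \<in> core_carrier" using g by (auto simp: core_carrier_def)
next
  fix g h assume "g \<in> core_carrier" "h \<in> core_carrier"
  then obtain a b a' b' where g: "g \<in> carrier K" "a \<in> E \<one>\<^bsub>H\<^esub>" "b \<in> E \<one>\<^bsub>H\<^esub>" "inv b \<preceq> g" "g \<preceq> a"
    and h: "h \<in> carrier K" "a' \<in> E \<one>\<^bsub>H\<^esub>" "b' \<in> E \<one>\<^bsub>H\<^esub>" "inv b' \<preceq> h" "h \<preceq> a'"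
    by (auto simp: core_carrier_def)
  note c = E_one_closed[OF g(2)] E_one_closed[OF g(3)] E_one_closed[OF h(2)] E_one_closed[OF h(3)]
  have "inv (b' \<otimes> b) \<preceq> g \<otimes> h"
    using K.mult_mono[of "inv b" g "inv b'" h] g h c by (simp add: K.inv_mult_group)
  moreover have "g \<otimes> h \<preceq> a \<otimes> a'"
    using K.mult_mono[of g a h a'] g h c by simp
  ultimately show "g \<otimes> h \<in> core_carrier"
    using g h E_one_mult by (auto simp: core_carrier_def)
qed

text \<open>An upper bound of g bounds the meet as well. From below, -(b + b') lies under -b and -b'
  because b and b' are positive.\<close>

lemma core_inf_closed:
  assumes "g \<in> core_carrier" "h \<in> core_carrier"
  shows "g \<sqinter>\<^bsub>order_of K\<^esub> h \<in> core_carrier"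
proof -
  obtain a b b' where g: "g \<in> carrier K" "a \<in> E \<one>\<^bsub>H\<^esub>" "b \<in> E \<one>\<^bsub>H\<^esub>" "inv b \<preceq> g" "g \<preceq> a"
    and h: "h \<in> carrier K" "b' \<in> E \<one>\<^bsub>H\<^esub>" "inv b' \<preceq> h"
    using assms by (auto simp: core_carrier_def)
  note c = E_one_closed[OF g(2)] E_one_closed[OF g(3)] E_one_closed[OF h(2)]
  note pos = E_mem(2)[OF one_in_interval g(3)] E_mem(2)[OF one_in_interval h(2)]
  have "inv (b \<otimes> b') \<preceq> inv b" "inv (b \<otimes> b') \<preceq> inv b'"
    using c pos K.le_mult_right[of b b'] K.le_mult_left[of b' b] K.inv_antimono_iff[of "b \<otimes> b'" b]
      K.inv_antimono_iff[of "b \<otimes> b'" b'] by auto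
  then have "inv (b \<otimes> b') \<preceq> g" "inv (b \<otimes> b') \<preceq> h"
    using g h c by (auto intro: K.po_trans[of _ "inv b"] K.po_trans[of _ "inv b'"])
  then have "inv (b \<otimes> b') \<preceq> g \<sqinter>\<^bsub>order_of K\<^esub> h"
    using g h c by (intro K.inf_greatest) auto
  moreover have "g \<sqinter>\<^bsub>order_of K\<^esub> h \<preceq> a"
    using K.po_trans[OF K.inf_left g(5)] g h c by simp
  ultimately show ?thesis
    using g h E_one_mult[OF g(3) h(2)] by (auto simp: core_carrier_def)
qed

lemma core_l_group: "l_group core"
proof (rule l_groupI)
  show "group core" unfolding core_def using core_subgroup K.is_group by (rule subgroup.subgroup_is_group)
next
  fix x y assume xy: "x \<in> carrier core" "y \<in> carrier core"
  then have c: "x \<in> carrier K" "y \<in> carrier K" by (auto dest: core_closed)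
  have "\<forall>z\<in>core_carrier. z \<preceq> x \<longrightarrow> z \<preceq> y \<longrightarrow> z \<preceq> x \<sqinter>\<^bsub>order_of K\<^esub> y"
    using c K.inf_greatest core_closed by blast
  then show "\<exists>m\<in>carrier core. m \<preceq>\<^bsub>core\<^esub> x \<and> m \<preceq>\<^bsub>core\<^esub> y \<and>
      (\<forall>z\<in>carrier core. z \<preceq>\<^bsub>core\<^esub> x \<longrightarrow> z \<preceq>\<^bsub>core\<^esub> y \<longrightarrow> z \<preceq>\<^bsub>core\<^esub> m)"
    using xy c core_inf_closed[of x y] K.inf_left[OF c] K.inf_right[OF c]
    by (intro bexI[of _ "x \<sqinter>\<^bsub>order_of K\<^esub> y"]) auto
qed (auto dest!: core_closed intro: K.po_refl K.po_antisym K.po_trans K.translation)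

lemma core_inv: "g \<in> core_carrier \<Longrightarrow> inv\<^bsub>core\<^esub> g = inv g"
  unfolding core_def using K.m_inv_consistent[OF core_subgroup] .

text \<open>A positive element of the core lies below some element of the bottom part, which is
  downward closed. Through this equality the decomposition determines \<open>core\<close>.\<close>

lemma core_positive: "positive_cone core = E \<one>\<^bsub>H\<^esub>"
proof
  show "positive_cone core \<subseteq> E \<one>\<^bsub>H\<^esub>"
    by (auto simp: positive_cone_def core_carrier_def intro: E_one_downset)
  show "E \<one>\<^bsub>H\<^esub> \<subseteq> positive_cone core"
  proof
    fix a assume a: "a \<in> E \<one>\<^bsub>H\<^esub>"
    moreover have "a \<in> carrier K" "inv \<one> \<preceq> a" "a \<preceq> a"
      using E_mem[OF one_in_interval a] K.po_refl by simp_all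
    ultimately show "a \<in> positive_cone core"
      using one_in_E unfolding positive_cone_def core_carrier_def core_simps by force
  qed
qed

text \<open>Needed for surjectivity of the coordinates: \<open>low\<close> and \<open>high\<close>
  say that (t, g) lies between 0 and (u, 0). Strictly between the ends g may have any sign, since
  adding or subtracting an element of index 0 does not move \<open>k t\<close> out of the
  interval.\<close>

lemma section_mult_core:
  assumes t: "t \<in> interval H u" and g: "g \<in> core_carrier"
    and low: "t = \<one>\<^bsub>H\<^esub> \<Longrightarrow> \<one> \<preceq> g" and high: "t = u \<Longrightarrow> g \<preceq> \<one>"
  shows "k t \<otimes> g \<in> E t"
proof -
  obtain a b where ab: "g \<in> carrier K" "a \<in> E \<one>\<^bsub>H\<^esub>" "b \<in> E \<one>\<^bsub>H\<^esub>" "inv b \<preceq> g" "g \<preceq> a"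
    using g by (auto simp: core_carrier_def)
  note c = ab(1) E_one_closed[OF ab(2)] E_one_closed[OF ab(3)] k_closed[OF t]
  note tc = H_interval[OF t]
  consider "t = \<one>\<^bsub>H\<^esub>" | "t = u" | "t \<noteq> \<one>\<^bsub>H\<^esub>" "t \<noteq> u" by blast
  then show ?thesis
  proof cases
    case 1
    then show ?thesis using E_one_downset[OF c(1) low ab(5,2)] k_one c by simp
  next
    case 2
    \<comment> \<open>At the top, w + g is the complement of -g, which is positive and belongs to
      the bottom part.\<close>
    have "inv g \<preceq> b" using ab c K.inv_antimono_iff[of g "inv b"] by simp
    moreover have "\<one> \<preceq> inv g" using high[OF 2] c by (simp add: K.one_le_inv_iff)
    ultimately have "inv g \<in> E \<one>\<^bsub>H\<^esub>" using E_one_downset[of "inv g" b] ab c by simp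
    then show ?thesis using E_neg[OF one_in_interval, of "inv g"] 2 k_unit c H.unit_closed by simp
  next
    case 3
    \<comment> \<open>The bounds a and b of g confine k t + g between k t - b and k t + a, and
      separation of t from 0 and u places both of these in the interval.\<close>
    have ta: "k t \<otimes> a \<preceq> w"
      using E_mult_small(1)[OF t one_in_interval k_in[OF t] ab(2)] tc 3 by simp
    have "b \<preceq> k t"
      using E_ordered[OF one_in_interval t tc(2) _ ab(3) k_in[OF t]] 3 by simp
    then have "\<one> \<preceq> k t \<otimes> inv b" using c by (simp add: K.le_divide_iff)
    then have "\<one> \<preceq> k t \<otimes> g"
      using K.mult_left_mono[of "inv b" g "k t"] K.po_trans[of \<one> "k t \<otimes> inv b" "k t \<otimes> g"] ab c by simp
    moreover have "k t \<otimes> g \<preceq> w"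
      using K.mult_left_mono[of g a "k t"] K.po_trans[of "k t \<otimes> g" "k t \<otimes> a" w] ta ab c K.unit_closed
      by simp
    ultimately have "k t \<otimes> g \<in> interval K w" using c by (simp add: interval_def)
    then obtain s where s: "s \<in> interval H u" "k t \<otimes> g \<in> E s" using E_union by blast
    text \<open>The product with \<open>b\<close> has index \<open>s\<close>, and it is the product of \<open>k t\<close> with a positive element.\<close>
    have "\<one> \<preceq> g \<otimes> b" using K.mult_right_mono[of "inv b" g b] ab c by simp
    moreover have "g \<otimes> b \<preceq> a \<otimes> b" using K.mult_right_mono[of g a b] ab c by simp
    ultimately have gb: "g \<otimes> b \<in> E \<one>\<^bsub>H\<^esub>"
      using E_one_downset[of "g \<otimes> b" "a \<otimes> b"] E_one_mult[OF ab(2,3)] c by simp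
    have "k t \<otimes> (g \<otimes> b) \<in> E t"
      using E_mult_small(2)[OF t one_in_interval k_in[OF t] gb] tc 3 by simp
    then have "s \<otimes>\<^bsub>H\<^esub> \<one>\<^bsub>H\<^esub> = t"
      using E_factor[OF s(1) t one_in_interval s(2) ab(3)] 3 c by (simp add: K.m_assoc)
    then show ?thesis using s H_interval(1)[OF s(1)] by simp
  qed
qed

section \<open>The coordinate map onto the lexicographic interval\<close>

definition index :: "'k \<Rightarrow> 'h" where
  "index x = (THE t. t \<in> interval H u \<and> x \<in> E t)"

lemma index_eq: "\<lbrakk>t \<in> interval H u; x \<in> E t\<rbrakk> \<Longrightarrow> index x = t"
  unfolding index_def using E_disjoint by (intro the_equality) blast+

lemma index_mem: "x \<in> interval K w \<Longrightarrow> index x \<in> interval H u \<and> x \<in> E (index x)"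
  using E_union index_eq by (metis UN_E)

definition split :: "'k \<Rightarrow> 'h \<times> 'k" where
  "split x = (index x, x \<otimes> inv k (index x))"

lemma split_eq: "\<lbrakk>t \<in> interval H u; x \<in> E t\<rbrakk> \<Longrightarrow> split x = (t, x \<otimes> inv k t)"
  by (simp add: split_def index_eq)

lemma lex_l_group: "l_group (H \<times>\<^sub>l\<^sub>e\<^sub>x core)"
  using H.l_group_axioms H_order core_l_group by (rule l_group_lex_prod)

text \<open>If u = 0, then \<open>H\<close> and \<open>core\<close> are both trivial, and already
  the zeroth multiple of the unit bounds everything.\<close>

lemma lex_unital: "unital_l_group (H \<times>\<^sub>l\<^sub>e\<^sub>x core) (u, \<one>\<^bsub>core\<^esub>)"
proof (cases "u = \<one>\<^bsub>H\<^esub>")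
  case False
  then show ?thesis
    by (rule unital_lex_prod[OF H.unital_l_group_axioms H_order core_l_group])
next
  case True
  interpret L: l_group "H \<times>\<^sub>l\<^sub>e\<^sub>x core" by (rule lex_l_group)
  have "h = \<one>\<^bsub>H\<^esub>" if "h \<in> carrier H" for h
    using H.strong_unit[OF that] that True by (auto intro: H.po_antisym)
  moreover have "g = \<one>" if "g \<in> core_carrier" for g
    using core_closed[OF that] trivial_unit(2)[OF True] by simp
  ultimately have triv: "x = \<one>\<^bsub>H \<times>\<^sub>l\<^sub>e\<^sub>x core\<^esub>" if "x \<in> carrier (H \<times>\<^sub>l\<^sub>e\<^sub>x core)" for x
    using that by (cases x) auto
  have u: "(u, \<one>\<^bsub>core\<^esub>) = \<one>\<^bsub>H \<times>\<^sub>l\<^sub>e\<^sub>x core\<^esub>" using True by simp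
  have "inv\<^bsub>H \<times>\<^sub>l\<^sub>e\<^sub>x core\<^esub> (\<one>\<^bsub>H \<times>\<^sub>l\<^sub>e\<^sub>x core\<^esub> [^]\<^bsub>H \<times>\<^sub>l\<^sub>e\<^sub>x core\<^esub> (0::nat)) \<preceq>\<^bsub>H \<times>\<^sub>l\<^sub>e\<^sub>x core\<^esub> x \<and>
      x \<preceq>\<^bsub>H \<times>\<^sub>l\<^sub>e\<^sub>x core\<^esub> \<one>\<^bsub>H \<times>\<^sub>l\<^sub>e\<^sub>x core\<^esub> [^]\<^bsub>H \<times>\<^sub>l\<^sub>e\<^sub>x core\<^esub> (0::nat)"
    if "x \<in> carrier (H \<times>\<^sub>l\<^sub>e\<^sub>x core)" for x
    using triv[OF that] L.po_refl[OF L.one_closed] L.inv_one L.nat_pow_0 by metis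
  then show ?thesis
    unfolding u using L.po_refl[OF L.one_closed] L.one_closed
    by (intro unital_l_group.intro lex_l_group unital_l_group_axioms.intro) blast+
qed

text \<open>In the lexicographic order the second coordinate is compared only when the first one
  ties with 0 or with u.\<close>

lemma interval_lex:
  "(t, g) \<in> interval (H \<times>\<^sub>l\<^sub>e\<^sub>x core) (u, \<one>\<^bsub>core\<^esub>) \<longleftrightarrow>
    t \<in> interval H u \<and> g \<in> core_carrier \<and> (t = \<one>\<^bsub>H\<^esub> \<longrightarrow> \<one> \<preceq> g) \<and> (t = u \<longrightarrow> g \<preceq> \<one>)"
  by (auto simp: interval_def H.po_refl H.unit_nonneg H.unit_closed)

lemma split_bij:
  "bij_betw split (interval K w) (interval (H \<times>\<^sub>l\<^sub>e\<^sub>x core) (u, \<one>\<^bsub>core\<^esub>))"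
proof (rule bij_betw_imageI)
  show "inj_on split (interval K w)"
  proof (rule inj_onI)
    fix x y assume x: "x \<in> interval K w" and y: "y \<in> interval K w" and eq: "split x = split y"
    then have "x \<otimes> inv k (index x) = y \<otimes> inv k (index x)" unfolding split_def by (metis Pair_inject)
    then show "x = y"
      using x y k_closed index_mem[OF x] by (simp add: interval_def)
  qed
  show "split ` interval K w = interval (H \<times>\<^sub>l\<^sub>e\<^sub>x core) (u, \<one>\<^bsub>core\<^esub>)"
  proof (intro equalityI subsetI)
    fix p assume "p \<in> split ` interval K w"
    then obtain x t where t: "t \<in> interval H u" "x \<in> E t" and p: "p = (t, x \<otimes> inv k t)"
      using index_mem by (auto simp: split_def)
    note xc = E_mem[OF t]
    have "x \<otimes> inv k t \<in> core_carrier"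
      using E_divide_section[OF t] xc k_closed[OF t(1)] by (auto simp: core_carrier_def)
    moreover have "\<one> \<preceq> x \<otimes> inv k t" if "t = \<one>\<^bsub>H\<^esub>" using that xc k_one by simp
    moreover have "x \<otimes> inv k t \<preceq> \<one>" if "t = u"
      using that xc k_unit K.unit_closed by (simp add: K.divide_le_iff)
    ultimately show "p \<in> interval (H \<times>\<^sub>l\<^sub>e\<^sub>x core) (u, \<one>\<^bsub>core\<^esub>)"
      using t unfolding p interval_lex by blast
  next
    fix p assume "p \<in> interval (H \<times>\<^sub>l\<^sub>e\<^sub>x core) (u, \<one>\<^bsub>core\<^esub>)"
    then obtain t g where p: "p = (t, g)" and t: "t \<in> interval H u" and g: "g \<in> core_carrier"
      and lh: "t = \<one>\<^bsub>H\<^esub> \<Longrightarrow> \<one> \<preceq> g" "t = u \<Longrightarrow> g \<preceq> \<one>"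
      using interval_lex by (cases p) blast
    have x: "k t \<otimes> g \<in> E t" using section_mult_core[OF t g lh] .
    have "split (k t \<otimes> g) = p"
      using split_eq[OF t x] k_central[OF t core_closed[OF g]] k_closed[OF t] core_closed[OF g] p
      by (simp add: K.m_assoc)
    moreover have "k t \<otimes> g \<in> interval K w" using E_union t x by blast
    ultimately show "p \<in> split ` interval K w" by blast
  qed
qed

text \<open>The sum of the indices decides how truncation acts: below u it does nothing, above u it
  returns the unit on both sides, and at u it acts on the second coordinate alone.\<close>

lemma split_mult:
  assumes "x \<in> interval K w" "y \<in> interval K w"
  shows "split ((x \<otimes> y) \<sqinter>\<^bsub>order_of K\<^esub> w) =
    (split x \<otimes>\<^bsub>H \<times>\<^sub>l\<^sub>e\<^sub>x core\<^esub> split y) \<sqinter>\<^bsub>order_of (H \<times>\<^sub>l\<^sub>e\<^sub>x core)\<^esub> (u, \<one>\<^bsub>core\<^esub>)"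
proof -
  interpret L: l_group "H \<times>\<^sub>l\<^sub>e\<^sub>x core" by (rule lex_l_group)
  interpret G: l_group core by (rule core_l_group)
  obtain s t where s: "s \<in> interval H u" "x \<in> E s" and t: "t \<in> interval H u" "y \<in> E t"
    using index_mem assms by blast
  note c = E_mem(1)[OF s] E_mem(1)[OF t] k_closed[OF s(1)] k_closed[OF t(1)] K.unit_closed
  note hc = H_interval(1)[OF s(1)] H_interval(1)[OF t(1)] H.unit_closed
  define g where "g = x \<otimes> y \<otimes> inv (k s \<otimes> k t)"
  have prod: "split x \<otimes>\<^bsub>H \<times>\<^sub>l\<^sub>e\<^sub>x core\<^esub> split y = (s \<otimes>\<^bsub>H\<^esub> t, g)"
  proof -
    \<comment> \<open>Centrality moves -k s past y, so the two second coordinates add up to x + y -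
      (k s + k t).\<close>
    have "inv k s \<otimes> y = y \<otimes> inv k s"
      using k_central[OF s(1), of "inv y"] c K.inv_mult_group[of "inv y" "k s"]
        K.inv_mult_group[of "k s" "inv y"] by simp
    moreover have "inv k s \<otimes> inv k t = inv (k s \<otimes> k t)"
      using k_central[OF s(1) c(4)] c by (simp add: K.inv_mult_group)
    ultimately have "x \<otimes> inv k s \<otimes> (y \<otimes> inv k t) = g"
      using c by (metis g_def K.inv_closed K.m_assoc K.m_closed)
    then show ?thesis by (simp add: split_eq[OF s] split_eq[OF t])
  qed
  have "split x \<in> carrier (H \<times>\<^sub>l\<^sub>e\<^sub>x core)" "split y \<in> carrier (H \<times>\<^sub>l\<^sub>e\<^sub>x core)"
    using split_bij assms by (auto simp: bij_betw_def interval_def)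
  then have pc: "(s \<otimes>\<^bsub>H\<^esub> t, g) \<in> carrier (H \<times>\<^sub>l\<^sub>e\<^sub>x core)" using prod L.m_closed by metis
  then have gc: "g \<in> core_carrier" by simp
  have uc: "(u, \<one>\<^bsub>core\<^esub>) \<in> carrier (H \<times>\<^sub>l\<^sub>e\<^sub>x core)" using H.unit_closed G.one_closed by simp
  let ?z = "(x \<otimes> y) \<sqinter>\<^bsub>order_of K\<^esub> w"
  consider "s \<otimes>\<^bsub>H\<^esub> t = u" | "s \<otimes>\<^bsub>H\<^esub> t \<preceq>\<^bsub>H\<^esub> u" "s \<otimes>\<^bsub>H\<^esub> t \<noteq> u" | "\<not> s \<otimes>\<^bsub>H\<^esub> t \<preceq>\<^bsub>H\<^esub> u" by blast
  then show ?thesis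
  proof cases
    case 1
    then have st: "s \<otimes>\<^bsub>H\<^esub> t \<preceq>\<^bsub>H\<^esub> u" using H.po_refl hc by simp
    have kst: "k s \<otimes> k t = w" using k_mult[OF s(1) t(1) st] 1 k_unit by simp
    have "?z \<in> E u" using E_plus[OF s(1) t(1) s(2) t(2)] st 1 by simp
    then have "split ?z = (u, ?z \<otimes> inv w)" using split_eq[OF unit_in_interval] k_unit by simp
    \<comment> \<open>Translating the meet of x + y and w by -w gives the meet of g and 0. This is
      the lexicographic meet, because both pairs have first coordinate u.\<close>
    also have "?z \<otimes> inv w = g \<sqinter>\<^bsub>order_of K\<^esub> \<one>"
      using K.inf_mult_right[of "x \<otimes> y" w "inv w"] c by (simp add: g_def kst)
    also have "(u, g \<sqinter>\<^bsub>order_of K\<^esub> \<one>) = (u, g) \<sqinter>\<^bsub>order_of (H \<times>\<^sub>l\<^sub>e\<^sub>x core)\<^esub> (u, \<one>\<^bsub>core\<^esub>)"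
    proof (rule L.inf_eqI[symmetric])
      note gk = core_closed[OF gc] K.one_closed
      show "(u, g \<sqinter>\<^bsub>order_of K\<^esub> \<one>) \<in> carrier (H \<times>\<^sub>l\<^sub>e\<^sub>x core)"
        using core_inf_closed[OF gc] G.one_closed hc by simp
      show "(u, g \<sqinter>\<^bsub>order_of K\<^esub> \<one>) \<preceq>\<^bsub>H \<times>\<^sub>l\<^sub>e\<^sub>x core\<^esub> (u, g)"
        "(u, g \<sqinter>\<^bsub>order_of K\<^esub> \<one>) \<preceq>\<^bsub>H \<times>\<^sub>l\<^sub>e\<^sub>x core\<^esub> (u, \<one>\<^bsub>core\<^esub>)"
        using K.inf_left[OF gk] K.inf_right[OF gk] by simp_all
      show "z \<preceq>\<^bsub>H \<times>\<^sub>l\<^sub>e\<^sub>x core\<^esub> (u, g \<sqinter>\<^bsub>order_of K\<^esub> \<one>)"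
        if "z \<in> carrier (H \<times>\<^sub>l\<^sub>e\<^sub>x core)" "z \<preceq>\<^bsub>H \<times>\<^sub>l\<^sub>e\<^sub>x core\<^esub> (u, g)"
          "z \<preceq>\<^bsub>H \<times>\<^sub>l\<^sub>e\<^sub>x core\<^esub> (u, \<one>\<^bsub>core\<^esub>)" for z
        using that K.inf_greatest[OF gk] by (cases z) (auto dest: core_closed)
    qed (use pc uc 1 in auto)
    finally show ?thesis using prod 1 by simp
  next
    case 2
    have z: "?z = x \<otimes> y" "x \<otimes> y \<in> E (s \<otimes>\<^bsub>H\<^esub> t)"
      using E_mult_small[OF s(1) t(1) s(2) t(2) 2] c by (simp_all add: K.inf_absorb1)
    have "split ?z = (s \<otimes>\<^bsub>H\<^esub> t, g)"
      using split_eq[OF mult_in_interval[OF s(1) t(1) 2(1)] z(2)] k_mult[OF s(1) t(1) 2(1)] z(1)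
      by (simp add: g_def)
    also have "\<dots> = (s \<otimes>\<^bsub>H\<^esub> t, g) \<sqinter>\<^bsub>order_of (H \<times>\<^sub>l\<^sub>e\<^sub>x core)\<^esub> (u, \<one>\<^bsub>core\<^esub>)"
      using L.inf_absorb1[OF pc uc] 2 by simp
    finally show ?thesis using prod by simp
  next
    case 3
    have z: "?z = w"
      using E_mult_large[OF s(1) t(1) s(2) t(2) 3] c by (simp add: K.inf_absorb2)
    have "w \<in> E u" using k_in[OF unit_in_interval] k_unit by simp
    then have "split ?z = (u, \<one>\<^bsub>core\<^esub>)"
      using split_eq[OF unit_in_interval] k_unit c z by simp
    moreover have "u \<preceq>\<^bsub>H\<^esub> s \<otimes>\<^bsub>H\<^esub> t" "u \<noteq> s \<otimes>\<^bsub>H\<^esub> t"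
      using H_total[of u "s \<otimes>\<^bsub>H\<^esub> t"] 3 hc H.po_refl by auto
    then have "(s \<otimes>\<^bsub>H\<^esub> t, g) \<sqinter>\<^bsub>order_of (H \<times>\<^sub>l\<^sub>e\<^sub>x core)\<^esub> (u, \<one>\<^bsub>core\<^esub>) = (u, \<one>\<^bsub>core\<^esub>)"
      using L.inf_absorb2[OF pc uc] by simp
    ultimately show ?thesis using prod by simp
  qed
qed

text \<open>The section respects complements, k (u - t) = w - k t, so subtracting it from w - x
  leaves -x + k t, the negative of x - k t. Both negations follow at once, as w is central and
  \<open>H\<close> is Abelian.\<close>

lemma split_neg:
  assumes "x \<in> interval K w"
  shows "split (w \<otimes> inv x) = (u, \<one>\<^bsub>core\<^esub>) \<otimes>\<^bsub>H \<times>\<^sub>l\<^sub>e\<^sub>x core\<^esub> inv\<^bsub>H \<times>\<^sub>l\<^sub>e\<^sub>x core\<^esub> split x"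
    and "split (inv x \<otimes> w) = inv\<^bsub>H \<times>\<^sub>l\<^sub>e\<^sub>x core\<^esub> split x \<otimes>\<^bsub>H \<times>\<^sub>l\<^sub>e\<^sub>x core\<^esub> (u, \<one>\<^bsub>core\<^esub>)"
proof -
  interpret G: l_group core by (rule core_l_group)
  obtain t where t: "t \<in> interval H u" "x \<in> E t"
    using index_mem assms by blast
  let ?t = "u \<otimes>\<^bsub>H\<^esub> inv\<^bsub>H\<^esub> t"
  note t' = complement_in_interval[OF t(1)]
  note c = E_mem(1)[OF t] k_closed[OF t(1)] k_closed[OF t'] K.unit_closed
  note hc = H_interval(1)[OF t(1)] H.unit_closed
  have tt: "?t \<otimes>\<^bsub>H\<^esub> t = u" using hc by (simp add: H.m_assoc)
  have "split x \<in> carrier (H \<times>\<^sub>l\<^sub>e\<^sub>x core)"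
    using split_bij assms by (auto simp: bij_betw_def interval_def)
  then have gc: "x \<otimes> inv k t \<in> core_carrier" by (simp add: split_eq[OF t])
  have "k ?t \<otimes> k t = w"
    using k_mult[OF t' t(1)] tt k_unit H.po_refl hc by simp
  then have "w \<otimes> inv k ?t = k t"
    using c k_central[OF t', of "k t"] K.inv_solve_right[of "k t" w "k ?t"] by simp
  then have "w \<otimes> inv x \<otimes> inv k ?t = inv x \<otimes> k t"
    using c inv_w_comm[OF c(1), symmetric] by (simp add: K.m_assoc)
  also have "\<dots> = inv (x \<otimes> inv k t)"
    using c k_central[OF t(1), of "inv x"] by (simp add: K.inv_mult_group)
  finally have "split (w \<otimes> inv x) = (?t, inv (x \<otimes> inv k t))"
    using split_eq[OF t' E_neg[OF t]] by simp
  moreover have "inv\<^bsub>H \<times>\<^sub>l\<^sub>e\<^sub>x core\<^esub> split x = (inv\<^bsub>H\<^esub> t, inv (x \<otimes> inv k t))"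
    using inv_lex_prod[OF H.group_axioms G.group_axioms hc(1), of "x \<otimes> inv k t"] gc
    by (simp add: split_eq[OF t] core_inv)
  ultimately show "split (w \<otimes> inv x) = (u, \<one>\<^bsub>core\<^esub>) \<otimes>\<^bsub>H \<times>\<^sub>l\<^sub>e\<^sub>x core\<^esub> inv\<^bsub>H \<times>\<^sub>l\<^sub>e\<^sub>x core\<^esub> split x"
    and "split (inv x \<otimes> w) = inv\<^bsub>H \<times>\<^sub>l\<^sub>e\<^sub>x core\<^esub> split x \<otimes>\<^bsub>H \<times>\<^sub>l\<^sub>e\<^sub>x core\<^esub> (u, \<one>\<^bsub>core\<^esub>)"
    using c hc inv_w_comm[OF c(1)] H.m_comm[of u "inv\<^bsub>H\<^esub> t"] by simp_all
qed

lemma split_iso: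
  "split \<in> pseudo_mv_iso (Gamma K w) (Gamma (H \<times>\<^sub>l\<^sub>e\<^sub>x core) (u, \<one>\<^bsub>core\<^esub>))"
proof -
  have "split \<one> = (\<one>\<^bsub>H\<^esub>, \<one>)" using split_eq[OF one_in_interval one_in_E] k_one by simp
  moreover have "split w = (u, \<one>)"
    using split_eq[OF unit_in_interval k_in[OF unit_in_interval]] k_unit K.unit_closed by simp
  ultimately show ?thesis
    using split_bij split_mult split_neg by (simp add: pseudo_mv_iso_def Gamma_def)
qed

lemma split_bottom: "split ` E \<one>\<^bsub>H\<^esub> = bottom_component H u core"
proof -
  interpret G: l_group core by (rule core_l_group)
  have "split a = (\<one>\<^bsub>H\<^esub>, a)" if "a \<in> E \<one>\<^bsub>H\<^esub>" for a
    using split_eq[OF one_in_interval that] k_one E_one_closed[OF that] by simp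
  then have "split ` E \<one>\<^bsub>H\<^esub> = {\<one>\<^bsub>H\<^esub>} \<times> E \<one>\<^bsub>H\<^esub>" by force
  then show ?thesis
    using bottom_component_eq[OF H.unital_l_group_axioms lex_unital G.group_axioms] core_positive
    by simp
qed

text \<open>By \<open>img\<close>, f restricts to a bijection between the positive cones of
  \<open>core\<close> and of \<open>G'\<close>. Sums of bottom elements are truncated on neither
  side, so this bijection is additive and extends to the groups.\<close>

lemma core_unique:
  assumes "l_group G'" "unital_l_group (H \<times>\<^sub>l\<^sub>e\<^sub>x G') (u, \<one>\<^bsub>G'\<^esub>)"
    and f: "f \<in> pseudo_mv_iso (Gamma K w) (Gamma (H \<times>\<^sub>l\<^sub>e\<^sub>x G') (u, \<one>\<^bsub>G'\<^esub>))"
    and img: "f ` E \<one>\<^bsub>H\<^esub> = bottom_component H u G'"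
  shows "l_group_isomorphic G' core"
proof -
  interpret G': l_group G' by fact
  interpret L: unital_l_group "H \<times>\<^sub>l\<^sub>e\<^sub>x G'" "(u, \<one>\<^bsub>G'\<^esub>)" by fact
  have img': "f ` E \<one>\<^bsub>H\<^esub> = {\<one>\<^bsub>H\<^esub>} \<times> positive_cone G'"
    using img bottom_component_eq[OF H.unital_l_group_axioms assms(2) G'.group_axioms] by simp
  then have f_eq: "fst (f a) = \<one>\<^bsub>H\<^esub>" "snd (f a) \<in> positive_cone G'" if "a \<in> E \<one>\<^bsub>H\<^esub>" for a
    using imageI[OF that, of f] by auto
  have E_sub: "E \<one>\<^bsub>H\<^esub> \<subseteq> interval K w" using E_union one_in_interval by blast
  have inj: "inj_on f (interval K w)"
    using f by (simp add: pseudo_mv_iso_def Gamma_def bij_betw_def)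
  have "bij_betw (snd \<circ> f) (positive_cone core) (positive_cone G')"
    unfolding core_positive
  proof (rule bij_betw_imageI)
    show "inj_on (snd \<circ> f) (E \<one>\<^bsub>H\<^esub>)"
    proof (rule inj_onI)
      fix a b assume "a \<in> E \<one>\<^bsub>H\<^esub>" "b \<in> E \<one>\<^bsub>H\<^esub>" "(snd \<circ> f) a = (snd \<circ> f) b"
      moreover from this have "f a = f b" using f_eq(1) by (intro prod_eqI) simp_all
      ultimately show "a = b" using inj_onD[OF inj] E_sub by blast
    qed
    show "(snd \<circ> f) ` E \<one>\<^bsub>H\<^esub> = positive_cone G'" by (simp only: image_comp[symmetric] img') simp
  qed
  moreover have "(snd \<circ> f) (a \<otimes>\<^bsub>core\<^esub> b) = (snd \<circ> f) a \<otimes>\<^bsub>G'\<^esub> (snd \<circ> f) b"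
    if "a \<in> positive_cone core" "b \<in> positive_cone core" for a b
  proof -
    have ab: "a \<in> E \<one>\<^bsub>H\<^esub>" "b \<in> E \<one>\<^bsub>H\<^esub>" using that core_positive by auto
    define g where "g = snd (f a) \<otimes>\<^bsub>G'\<^esub> snd (f b)"
    have gc: "g \<in> carrier G'" using f_eq(2) ab by (auto simp: g_def positive_cone_def)
    have "(a \<otimes> b) \<sqinter>\<^bsub>order_of K\<^esub> w = a \<otimes> b"
      using E_mem[OF one_in_interval E_one_mult[OF ab]] K.unit_closed by (simp add: K.inf_absorb1)
    moreover have "f ((a \<otimes> b) \<sqinter>\<^bsub>order_of K\<^esub> w) =
        (f a \<otimes>\<^bsub>H \<times>\<^sub>l\<^sub>e\<^sub>x G'\<^esub> f b) \<sqinter>\<^bsub>order_of (H \<times>\<^sub>l\<^sub>e\<^sub>x G')\<^esub> (u, \<one>\<^bsub>G'\<^esub>)"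
      using f ab E_sub by (auto simp: pseudo_mv_iso_def Gamma_def)
    moreover have "f a \<otimes>\<^bsub>H \<times>\<^sub>l\<^sub>e\<^sub>x G'\<^esub> f b = (\<one>\<^bsub>H\<^esub>, g)"
      using f_eq(1)[OF ab(1)] f_eq(1)[OF ab(2)] by (cases "f a", cases "f b") (simp add: g_def)
    \<comment> \<open>The unit (u, 0) dominates the whole bottom component, so the meet on the side
      of \<open>G'\<close> has no effect.\<close>
    moreover have "(\<one>\<^bsub>H\<^esub>, g) \<sqinter>\<^bsub>order_of (H \<times>\<^sub>l\<^sub>e\<^sub>x G')\<^esub> (u, \<one>\<^bsub>G'\<^esub>) = (\<one>\<^bsub>H\<^esub>, g)"
      using bottom_le_unit[OF H.unital_l_group_axioms assms(2) gc G'.group_axioms] gc L.unit_closed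
      by (intro L.inf_absorb1) simp_all
    ultimately show ?thesis by (simp add: g_def)
  qed
  ultimately have "l_group_isomorphic core G'"
    using positive_cone_iso_extends[OF core_l_group assms(1)] by blast
  then show ?thesis using l_group_isomorphic_sym[OF core_l_group] by blast
qed

end


section \<open>Transport from the algebra to the interval of \<open>K\<close>\<close>

context strong_hu_perfect
begin

lemma part_closed: "t \<in> interval H u \<Longrightarrow> x \<in> D t \<Longrightarrow> x \<in> carrier M"
  using parts_union by blast

lemma \<phi>_closed: "x \<in> carrier M \<Longrightarrow> \<phi> x \<in> interval K w"
  using \<phi>_iso by (auto simp: pseudo_mv_iso_def Gamma_def bij_betw_def)

lemma \<phi>_inj: "inj_on \<phi> (carrier M)"
  using \<phi>_iso by (simp add: pseudo_mv_iso_def bij_betw_def)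

lemma \<phi>_image: "\<phi> ` carrier M = interval K w"
  using \<phi>_iso by (simp add: pseudo_mv_iso_def Gamma_def bij_betw_def)

lemma \<phi>_mplus: "\<lbrakk>x \<in> carrier M; y \<in> carrier M\<rbrakk>
    \<Longrightarrow> \<phi> (x \<boxplus>\<^bsub>M\<^esub> y) = (\<phi> x \<otimes>\<^bsub>K\<^esub> \<phi> y) \<sqinter>\<^bsub>order_of K\<^esub> w"
  using \<phi>_iso by (simp add: pseudo_mv_iso_def Gamma_def)

lemma \<phi>_lneg: "x \<in> carrier M \<Longrightarrow> \<phi> (lneg M x) = w \<otimes>\<^bsub>K\<^esub> inv\<^bsub>K\<^esub> \<phi> x"
  and \<phi>_rneg: "x \<in> carrier M \<Longrightarrow> \<phi> (rneg M x) = inv\<^bsub>K\<^esub> \<phi> x \<otimes>\<^bsub>K\<^esub> w"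
  and \<phi>_zero: "\<phi> (mzero M) = \<one>\<^bsub>K\<^esub>"
  and \<phi>_one: "\<phi> (mone M) = w"
  using \<phi>_iso by (simp_all add: pseudo_mv_iso_def Gamma_def)

lemma mtimes_closed: "\<lbrakk>x \<in> carrier M; y \<in> carrier M\<rbrakk> \<Longrightarrow> x \<boxdot>\<^bsub>M\<^esub> y \<in> carrier M"
  by (simp add: mtimes_def mplus_closed lneg_closed rneg_closed)

text \<open>The relation \<open>mle\<close> exhibits y as the truncated sum of x and some z of the
  algebra. Its image dominates that of x, because z becomes positive in \<open>K\<close> and x stays
  below w.\<close>

lemma mle_imp_le:
  assumes "x \<in> carrier M" "y \<in> carrier M" "mle M x y"
  shows "\<phi> x \<preceq>\<^bsub>K\<^esub> \<phi> y"
proof -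
  interpret K: unital_l_group K w by (rule unital_K)
  define z where "z = rneg M x \<boxdot>\<^bsub>M\<^esub> y"
  have z: "z \<in> carrier M" using assms by (simp add: z_def mtimes_closed rneg_closed)
  have "\<phi> y = (\<phi> x \<otimes>\<^bsub>K\<^esub> \<phi> z) \<sqinter>\<^bsub>order_of K\<^esub> w"
    using assms z \<phi>_mplus[of x z] by (simp add: mle_def z_def)
  moreover have "\<phi> x \<preceq>\<^bsub>K\<^esub> (\<phi> x \<otimes>\<^bsub>K\<^esub> \<phi> z) \<sqinter>\<^bsub>order_of K\<^esub> w"
    using \<phi>_closed[OF assms(1)] \<phi>_closed[OF z] K.unit_closed
    by (intro K.inf_greatest K.le_mult_right) (simp_all add: interval_def)
  ultimately show ?thesis by simp
qed

text \<open>The product of x and y becomes the join of x - w + y with 0, so its vanishing bounds the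
  sum in reversed order, y + x. In a noncommutative \<open>K\<close> this differs from bounding x +
  y.\<close>

lemma partial_sum_le:
  assumes "x \<in> carrier M" "y \<in> carrier M" "x \<boxdot>\<^bsub>M\<^esub> y = mzero M"
  shows "\<phi> y \<otimes>\<^bsub>K\<^esub> \<phi> x \<preceq>\<^bsub>K\<^esub> w"
proof -
  interpret K: unital_l_group K w by (rule unital_K)
  define a b where "a = \<phi> x" and "b = \<phi> y"
  have c: "a \<in> carrier K" "b \<in> carrier K" "w \<in> carrier K"
    using \<phi>_closed[OF assms(1)] \<phi>_closed[OF assms(2)] K.unit_closed by (auto simp: a_def b_def interval_def)
  define p where "p = w \<otimes>\<^bsub>K\<^esub> inv\<^bsub>K\<^esub> b \<otimes>\<^bsub>K\<^esub> (w \<otimes>\<^bsub>K\<^esub> inv\<^bsub>K\<^esub> a)"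
  have p: "p \<in> carrier K" using c by (simp add: p_def)
  have "\<phi> (x \<boxdot>\<^bsub>M\<^esub> y) = inv\<^bsub>K\<^esub> (p \<sqinter>\<^bsub>order_of K\<^esub> w) \<otimes>\<^bsub>K\<^esub> w"
    using assms(1,2)
    by (simp add: mtimes_def \<phi>_rneg \<phi>_mplus \<phi>_lneg lneg_closed mplus_closed p_def a_def b_def)
  then have "inv\<^bsub>K\<^esub> (p \<sqinter>\<^bsub>order_of K\<^esub> w) \<otimes>\<^bsub>K\<^esub> w = \<one>\<^bsub>K\<^esub>"
    using assms(3) \<phi>_zero by simp
  then have "p \<sqinter>\<^bsub>order_of K\<^esub> w = w"
    using p c by (metis K.inf_closed K.inv_solve_left' K.one_closed K.r_one)
  then have "w \<preceq>\<^bsub>K\<^esub> p" using K.inf_left[OF p c(3)] by simp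
  then have "w \<otimes>\<^bsub>K\<^esub> a \<preceq>\<^bsub>K\<^esub> w \<otimes>\<^bsub>K\<^esub> inv\<^bsub>K\<^esub> b \<otimes>\<^bsub>K\<^esub> w"
    using c by (simp add: p_def K.le_divide_iff K.m_assoc[symmetric])
  then have "a \<preceq>\<^bsub>K\<^esub> inv\<^bsub>K\<^esub> b \<otimes>\<^bsub>K\<^esub> w"
    using c K.le_ldivide_iff[of a "w \<otimes>\<^bsub>K\<^esub> inv\<^bsub>K\<^esub> b \<otimes>\<^bsub>K\<^esub> w" w] by (simp add: K.m_assoc[symmetric])
  then show ?thesis using c by (simp add: a_def b_def K.le_ldivide_iff)
qed

lemma central_decomposition_image:
  assumes "unital_l_group H u" "comm_group H" "total_order (order_of H)"
  shows "central_decomposition K w H u (\<lambda>t. \<phi> ` D t) (\<lambda>t. \<phi> (c t))"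
proof -
  interpret H: unital_l_group H u by fact
  interpret K: unital_l_group K w by (rule unital_K)
  have c_closed: "c t \<in> carrier M" if "t \<in> interval H u" for t
    using part_closed[OF that c_in_part[OF that]] .
  have c_in_K: "\<phi> (c t) \<in> carrier K" if "t \<in> interval H u" for t
    using \<phi>_closed[OF c_closed[OF that]] by (simp add: interval_def)
  show ?thesis
  proof (intro central_decomposition.intro central_decomposition_axioms.intro unital_K assms)
    show "(\<Union>t\<in>interval H u. \<phi> ` D t) = interval K w"
      using parts_union \<phi>_image by (simp flip: image_UN)
  next
    fix s t x assume st: "s \<in> interval H u" "t \<in> interval H u" and "x \<in> \<phi> ` D s" "x \<in> \<phi> ` D t"
    then obtain y z where yz: "y \<in> D s" "z \<in> D t" "\<phi> y = \<phi> z" by auto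
    then have "y = z" using part_closed st \<phi>_inj by (meson inj_onD)
    then show "s = t" using parts_disjoint[OF st] yz by blast
  next
    fix s t a b
    assume "s \<in> interval H u" "t \<in> interval H u" "s \<preceq>\<^bsub>H\<^esub> t" "s \<noteq> t" "a \<in> \<phi> ` D s" "b \<in> \<phi> ` D t"
    then show "a \<preceq>\<^bsub>K\<^esub> b" using parts_ordered mle_imp_le part_closed by blast
  next
    fix t x assume t: "t \<in> interval H u" and "x \<in> \<phi> ` D t"
    then obtain y where y: "y \<in> D t" "x = \<phi> y" by auto
    then have "lneg M y \<in> D (u \<otimes>\<^bsub>H\<^esub> inv\<^bsub>H\<^esub> t)" using parts_lneg[OF t] by blast
    then show "w \<otimes>\<^bsub>K\<^esub> inv\<^bsub>K\<^esub> x \<in> \<phi> ` D (u \<otimes>\<^bsub>H\<^esub> inv\<^bsub>H\<^esub> t)"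
      using y \<phi>_lneg[OF part_closed[OF t]] by (metis imageI)
  next
    fix s t x y
    assume st: "s \<in> interval H u" "t \<in> interval H u" and "x \<in> \<phi> ` D s" "y \<in> \<phi> ` D t"
    then obtain a b where ab: "a \<in> D s" "b \<in> D t" "x = \<phi> a" "y = \<phi> b" by auto
    show "(x \<otimes>\<^bsub>K\<^esub> y) \<sqinter>\<^bsub>order_of K\<^esub> w \<in> \<phi> ` D (if s \<otimes>\<^bsub>H\<^esub> t \<preceq>\<^bsub>H\<^esub> u then s \<otimes>\<^bsub>H\<^esub> t else u)"
      using imageI[OF parts_mplus[OF st ab(1,2)], of \<phi>] ab(3,4)
        \<phi>_mplus[OF part_closed[OF st(1) ab(1)] part_closed[OF st(2) ab(2)]] by simp
  next
    fix t assume "t \<in> interval H u"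
    then show "\<phi> (c t) \<in> \<phi> ` D t" using c_in_part by blast
  next
    fix t x assume "t \<in> interval H u" "x \<in> carrier K"
    then show "\<phi> (c t) \<otimes>\<^bsub>K\<^esub> x = x \<otimes>\<^bsub>K\<^esub> \<phi> (c t)"
      using c_central by (simp add: commutative_center_def)
  next
    fix s t assume st: "s \<in> interval H u" "t \<in> interval H u" "s \<otimes>\<^bsub>H\<^esub> t \<preceq>\<^bsub>H\<^esub> u"
    have sum: "c s \<boxdot>\<^bsub>M\<^esub> c t = mzero M" "c s \<boxplus>\<^bsub>M\<^esub> c t = c (s \<otimes>\<^bsub>H\<^esub> t)"
      using c_sum[OF st] by (auto simp: is_partial_sum_def)
    \<comment> \<open>Centrality repairs the reversed order in \<open>partial_sum_le\<close>. The
      partial sum is then untruncated and becomes an equation in \<open>K\<close>.\<close>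
    have "\<phi> (c t) \<otimes>\<^bsub>K\<^esub> \<phi> (c s) = \<phi> (c s) \<otimes>\<^bsub>K\<^esub> \<phi> (c t)"
      using c_central[OF st(2)] c_in_K[OF st(1)] by (simp add: commutative_center_def)
    then have "\<phi> (c s) \<otimes>\<^bsub>K\<^esub> \<phi> (c t) \<preceq>\<^bsub>K\<^esub> w"
      using partial_sum_le[OF c_closed[OF st(1)] c_closed[OF st(2)] sum(1)] by simp
    then show "\<phi> (c (s \<otimes>\<^bsub>H\<^esub> t)) = \<phi> (c s) \<otimes>\<^bsub>K\<^esub> \<phi> (c t)"
      using \<phi>_mplus[OF c_closed[OF st(1)] c_closed[OF st(2)]] sum(2) c_in_K st K.unit_closed
      by (simp add: K.inf_absorb1)
  next
    show "\<phi> (c u) = w" using c_unit \<phi>_one by simp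
  qed
qed

end

theorem theorem4p2:
  fixes H :: "'h po_group" and u :: 'h
    and M :: "'m pseudo_mv" and D :: "'h \<Rightarrow> 'm set" and c :: "'h \<Rightarrow> 'm"
    and K :: "'k po_group" and w :: 'k and \<phi> :: "'m \<Rightarrow> 'k"
  assumes "unital_l_group H u"
    and "comm_group H"
    and "total_order (order_of H)"
    and "strong_hu_perfect H u M D K w \<phi> c"
  shows "\<exists>G :: 'k po_group.
    l_group G \<and> unital_l_group (H \<times>\<^sub>l\<^sub>e\<^sub>x G) (u, \<one>\<^bsub>G\<^esub>) \<and>
    (\<exists>f \<in> pseudo_mv_iso M (Gamma (H \<times>\<^sub>l\<^sub>e\<^sub>x G) (u, \<one>\<^bsub>G\<^esub>)).
      f ` D \<one>\<^bsub>H\<^esub> = bottom_component H u G) \<and>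
    (\<forall>G' :: 'g po_group.
      l_group G' \<and> unital_l_group (H \<times>\<^sub>l\<^sub>e\<^sub>x G') (u, \<one>\<^bsub>G'\<^esub>) \<and>
      (\<exists>f \<in> pseudo_mv_iso M (Gamma (H \<times>\<^sub>l\<^sub>e\<^sub>x G') (u, \<one>\<^bsub>G'\<^esub>)).
        f ` D \<one>\<^bsub>H\<^esub> = bottom_component H u G')
      \<longrightarrow> l_group_isomorphic G' G)"
proof -
  interpret S: strong_hu_perfect H u M D K w \<phi> c by fact
  interpret C: central_decomposition K w H u "\<lambda>t. \<phi> ` D t" "\<lambda>t. \<phi> (c t)"
    using assms(1-3) by (rule S.central_decomposition_image)
  show ?thesis
  proof (intro exI[of _ C.core] conjI allI impI)
    show "l_group C.core" by (rule C.core_l_group)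
    show "unital_l_group (H \<times>\<^sub>l\<^sub>e\<^sub>x C.core) (u, \<one>\<^bsub>C.core\<^esub>)" by (rule C.lex_unital)
    show "\<exists>f \<in> pseudo_mv_iso M (Gamma (H \<times>\<^sub>l\<^sub>e\<^sub>x C.core) (u, \<one>\<^bsub>C.core\<^esub>)).
        f ` D \<one>\<^bsub>H\<^esub> = bottom_component H u C.core"
      using pseudo_mv_iso_comp[OF S.\<phi>_iso C.split_iso] C.split_bottom
      by (intro bexI[of _ "C.split \<circ> \<phi>"]) (simp_all add: image_comp)
  next
    fix G' :: "'g po_group"
    assume G': "l_group G' \<and> unital_l_group (H \<times>\<^sub>l\<^sub>e\<^sub>x G') (u, \<one>\<^bsub>G'\<^esub>) \<and>
      (\<exists>f \<in> pseudo_mv_iso M (Gamma (H \<times>\<^sub>l\<^sub>e\<^sub>x G') (u, \<one>\<^bsub>G'\<^esub>)).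
        f ` D \<one>\<^bsub>H\<^esub> = bottom_component H u G')"
    then obtain f where f: "f \<in> pseudo_mv_iso M (Gamma (H \<times>\<^sub>l\<^sub>e\<^sub>x G') (u, \<one>\<^bsub>G'\<^esub>))"
      and img: "f ` D \<one>\<^bsub>H\<^esub> = bottom_component H u G'"
      by blast
    \<comment> \<open>Uniqueness was established for isomorphisms that start from the interval of
      \<open>K\<close>, hence the detour through the inverse of \<phi>. Injectivity of \<phi>
      ensures that the bottom part is carried back to itself.\<close>
    let ?g = "f \<circ> inv_into (carrier M) \<phi>"
    have "inv_into (carrier M) \<phi> ` \<phi> ` D \<one>\<^bsub>H\<^esub> = D \<one>\<^bsub>H\<^esub>"
      using S.\<phi>_inj S.part_closed[OF C.one_in_interval] by (intro inv_into_image_cancel) blast+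
    then have "?g ` \<phi> ` D \<one>\<^bsub>H\<^esub> = bottom_component H u G'"
      using img by (simp only: image_comp[symmetric])
    then show "l_group_isomorphic G' C.core"
      using C.core_unique[OF _ _ pseudo_mv_iso_comp[OF S.pseudo_mv_iso_inv[OF S.\<phi>_iso] f]] G' by blast
  qed
qed

end
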